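(* Let $h\ge 1$ be an integer. If $G$ is a finite simple graph with maximum degree $\Delta(G)\ge h+2$, then $\chi^h_{\mathrm{pcf}}(G)\le (h+1)\Delta(G)-1$.
   Context: All graphs are finite and simple. For a positive integer $k$, a proper $k$-coloring of $G$ assigns each vertex a color in $\{1,\dots,k\}$ so that adjacent vertices receive different colors. For a positive integer $h$ and a vertex $v$, let $h_v=\min\{\deg_G(v),h\}$. A proper $h$-conflict-free $k$-coloring of $G$ is a proper $k$-coloring such that for every vertex $v$, at least $h_v$ distinct colors each appear exactly once on the neighborhood $N_G(v)$. The proper $h$-conflict-free chromatic number $\chi^h_{\mathrm{pcf}}(G)$ is the minimum $k$ such that $G$ has a proper $h$-conflict-free $k$-coloring. *)

theory Defs
  imports "Graph_Theory.Digraph"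
begin

text \<open>
  Finite simple graphs are rendered by the locale \<^locale>\<open>graph\<close>: finite, loop-free digraphs
  without parallel arcs whose arc relation is symmetric, so that an undirected edge is a pair
  of opposite arcs.
\<close>

definition nbhd :: "('a, 'b) pre_digraph \<Rightarrow> 'a \<Rightarrow> 'a set" where
  "nbhd G v = {u. v \<rightarrow>\<^bsub>G\<^esub> u}"

definition vertex_degree :: "('a, 'b) pre_digraph \<Rightarrow> 'a \<Rightarrow> nat" where
  "vertex_degree G v = card (nbhd G v)"

text \<open>Inserting 0 only fixes the value for the graph without vertices.\<close>

definition max_degree :: "('a, 'b) pre_digraph \<Rightarrow> nat" where
  "max_degree G = Max (insert 0 (vertex_degree G ` verts G))"

text \<open>Colorings are total functions; their values outside \<^term>\<open>verts G\<close> are irrelevant.\<close>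

definition proper_coloring :: "('a, 'b) pre_digraph \<Rightarrow> nat \<Rightarrow> ('a \<Rightarrow> nat) \<Rightarrow> bool" where
  "proper_coloring G k c \<longleftrightarrow>
     (\<forall>v \<in> verts G. c v \<in> {1..k}) \<and> (\<forall>u v. u \<rightarrow>\<^bsub>G\<^esub> v \<longrightarrow> c u \<noteq> c v)"

definition pcf_coloring :: "('a, 'b) pre_digraph \<Rightarrow> nat \<Rightarrow> nat \<Rightarrow> ('a \<Rightarrow> nat) \<Rightarrow> bool" where
  "pcf_coloring G h k c \<longleftrightarrow> proper_coloring G k c \<and>
     (\<forall>v \<in> verts G. min (vertex_degree G v) h \<le>
        card {i \<in> {1..k}. card {u \<in> nbhd G v. c u = i} = 1})"

definition pcf_chromatic_number :: "('a, 'b) pre_digraph \<Rightarrow> nat \<Rightarrow> nat" where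
  "pcf_chromatic_number G h = (LEAST k. 0 < k \<and> (\<exists>c. pcf_coloring G h k c))"

text \<open>
  An injective coloring is always proper conflict-free, so the minimum in
  \<^const>\<open>pcf_chromatic_number\<close> ranges over a nonempty set and is attained.
\<close>

lemma (in graph) pcf_coloring_exists: "\<exists>k c. 0 < k \<and> pcf_coloring G h k c"
proof -
  obtain f where f: "bij_betw f (verts G) {0..<card (verts G)}"
    using ex_bij_betw_finite_nat[OF finite_verts] by blast
  define c where "c v = Suc (f v)" for v
  define k where "k = Suc (card (verts G))"
  have inj: "inj_on c (verts G)"
    using f by (auto simp: c_def bij_betw_def inj_on_def)
  have range: "c v \<in> {1..k}" if "v \<in> verts G" for v
    using bij_betwE[OF f] that by (fastforce simp: c_def k_def)
  have adj: "u \<in> verts G \<and> v \<in> verts G \<and> u \<noteq> v" if "u \<rightarrow>\<^bsub>G\<^esub> v" for u v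
    using that no_loops by (auto simp: arcs_ends_conv)
  have proper: "proper_coloring G k c"
    unfolding proper_coloring_def using range adj inj by (meson inj_onD)
  have "min (vertex_degree G v) h \<le> card {i \<in> {1..k}. card {u \<in> nbhd G v. c u = i} = 1}"
    for v
  proof -
    have sub: "nbhd G v \<subseteq> verts G"
      using adj by (auto simp: nbhd_def)
    have single: "{u \<in> nbhd G v. c u = c w} = {w}" if "w \<in> nbhd G v" for w
      using that sub inj by (auto dest: inj_onD)
    have "c ` nbhd G v \<subseteq> {i \<in> {1..k}. card {u \<in> nbhd G v. c u = i} = 1}"
      using range sub single by (auto simp del: atLeastAtMost_iff)
    then have "card (c ` nbhd G v) \<le> card {i \<in> {1..k}. card {u \<in> nbhd G v. c u = i} = 1}"
      by (intro card_mono) auto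
    moreover have "card (c ` nbhd G v) = vertex_degree G v"
      unfolding vertex_degree_def using inj sub by (meson card_image inj_on_subset)
    ultimately show ?thesis by simp
  qed
  with proper have "pcf_coloring G h k c" by (simp add: pcf_coloring_def)
  then show ?thesis by (auto simp: k_def)
qed

lemma (in graph) pcf_chromatic_number_attained:
  "0 < pcf_chromatic_number G h \<and> (\<exists>c. pcf_coloring G h (pcf_chromatic_number G h) c)"
proof -
  have "\<exists>k. 0 < k \<and> (\<exists>c. pcf_coloring G h k c)"
    using pcf_coloring_exists by blast
  then show ?thesis
    unfolding pcf_chromatic_number_def by (rule LeastI_ex)
qed

end

theory Submission
  imports Defs
begin

text \<open>
  Fix \<open>k = (h + 1) * D - 1\<close> colors. A partial coloring is kept valid in the sense that every vertex
  already sees \<open>h\<close> unique colors, or only unique ones. An uncolored vertex \<open>u\<close> then has to avoid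
  the color of each neighbor \<open>w\<close> and at most \<open>h\<close> further colors on account of \<open>w\<close>, so it is
  stuck only if it has degree \<open>D\<close>, at most one uncolored neighbor, and almost no color is excluded
  twice. If it has exactly one, then all exclusions are distinct and every neighbor of \<open>u\<close> sees a
  repeated color. For a neighbor \<open>x\<close> of \<open>u\<close> that was colored last, this repetition leaves
  \<open>x\<close> a second choice; recoloring \<open>x\<close> releases its old color, which \<open>u\<close> can take.
  Proceeding in the order of a depth-first search, where the last child is always such an
  \<open>x\<close>, everything can be colored except a prescribed nonempty vertex set of a connected graph.

  A vertex of degree less than \<open>D\<close> is never stuck, so in a graph that is not regular one leaves
  out such a vertex. In a regular graph one leaves out a shortest cycle. It is chordless, and
  what remains is a list coloring problem on the cycle where the colors of the two neighbors of each
  vertex interact; it is solved separately for \<open>D = h + 2\<close>, \<open>D = h + 3\<close> and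
  \<open>D \<ge> h + 4\<close>.
\<close>


section \<open>Colors occurring once\<close>

text \<open>The number of colors is one less than the greedy count: \<open>D\<close> neighbors, each
  with its own color and at most \<open>h\<close> further exclusions, exclude up to
  \<open>(h + 1) * D\<close>. With one neighbor uncolored the count is exactly \<open>k\<close>, so
  being stuck forces equality everywhere, and this rigidity makes the recoloring work. With all
  neighbors colored the count exceeds \<open>k\<close>, so the end of the order needs another
  argument. The obstacle is \<open>D = h + 2\<close>: a vertex of degree \<open>h + 2\<close> with
  exactly \<open>h\<close> colored neighbors would exclude \<open>h\<close> colors, which the
  recoloring cannot afford. Hence one coincidence is tolerated at such vertices. The cycle is
  shortest so that an outside vertex has at most two neighbors on it, or three on a triangle, and is
  served by withdrawing at most \<open>h\<close> colors from each of them. A cycle vertex has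
  \<open>D - 2\<close> outside neighbors, and \<open>k - h * (D - 2) = D - 1 + 2 * h\<close> bounds
  what remains. The ranges of \<open>D\<close> differ in how many unique colors a cycle vertex can
  spare: none for \<open>h + 2\<close>, one for \<open>h + 3\<close>; beyond that it can spare two
  or has a longer list.\<close>

definition uniques :: "('a \<Rightarrow> nat) \<Rightarrow> 'a set \<Rightarrow> nat set" where
  "uniques c A = {a. card {u \<in> A. c u = a} = 1}"

lemma uniques_iff: "a \<in> uniques c A \<longleftrightarrow> (\<exists>u\<in>A. c u = a \<and> (\<forall>v\<in>A. c v = a \<longrightarrow> v = u))"
proof -
  have "card {u \<in> A. c u = a} = 1 \<longleftrightarrow> (\<exists>u. {u \<in> A. c u = a} = {u})"
    by (simp add: card_1_singleton_iff)
  also have "\<dots> \<longleftrightarrow> (\<exists>u\<in>A. c u = a \<and> (\<forall>v\<in>A. c v = a \<longrightarrow> v = u))"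
    by blast
  finally show ?thesis by (simp add: uniques_def)
qed

lemma uniques_subset: "uniques c A \<subseteq> c ` A"
  by (auto simp: uniques_iff)

lemma finite_uniques [simp]: "finite A \<Longrightarrow> finite (uniques c A)"
  using uniques_subset finite_subset by (metis finite_imageI)

lemma uniques_cong: "(\<And>u. u \<in> A \<Longrightarrow> c u = c' u) \<Longrightarrow> uniques c A = uniques c' A"
  by (force simp: uniques_iff set_eq_iff)

lemma uniques_inj_on: "inj_on c A \<Longrightarrow> uniques c A = c ` A"
  unfolding set_eq_iff uniques_iff inj_on_def by blast

lemma inj_on_if_uniques_full:
  assumes "c ` A \<subseteq> uniques c A"
  shows "inj_on c A"
proof (rule inj_onI)
  fix x y assume "x \<in> A" "y \<in> A" "c x = c y"
  moreover from this assms have "c x \<in> uniques c A" by blast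
  ultimately show "x = y" by (auto simp: uniques_iff)
qed

text \<open>A color class has at least two elements unless its color is unique, and then the extra
  term makes up for it. This turns a bound on repetitions into a number of unique colors.\<close>

lemma two_image_le_card_add_uniques:
  assumes "finite A"
  shows "2 * card (c ` A) \<le> card A + card (uniques c A)"
proof -
  let ?f = "\<lambda>a. card {u \<in> A. c u = a}"
  have "card A = (\<Sum>a\<in>c ` A. ?f a)"
    using card_eq_sum sum.image_gen[OF assms, of "\<lambda>_. 1::nat" c] by simp
  moreover have "card (uniques c A) = (\<Sum>a\<in>c ` A. if ?f a = 1 then 1 else 0)"
  proof -
    have "uniques c A = {a \<in> c ` A. ?f a = 1}"
      using uniques_subset[of c A] by (auto simp: uniques_def)
    then show ?thesis using assms by (simp add: sum.If_cases Int_def)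
  qed
  moreover have "2 \<le> ?f a + (if ?f a = 1 then 1 else 0)" if "a \<in> c ` A" for a
  proof -
    have "?f a \<noteq> 0" using that assms by auto
    then show ?thesis by auto
  qed
  then have "(\<Sum>a\<in>c ` A. 2) \<le> (\<Sum>a\<in>c ` A. ?f a + (if ?f a = 1 then 1 else 0))"
    by (intro sum_mono) auto
  ultimately show ?thesis by (simp add: sum.distrib)
qed

lemma card_uniques_less:
  assumes "finite A" "\<not> inj_on c A"
  shows "card (uniques c A) < card (c ` A)" "card (c ` A) < card A"
proof -
  show "card (uniques c A) < card (c ` A)"
    using inj_on_if_uniques_full[of c A] uniques_subset[of c A] assms
    by (metis finite_imageI psubsetI psubset_card_mono subset_refl)
  show "card (c ` A) < card A"
    using assms by (meson card_image_le eq_card_imp_inj_on le_neq_implies_less)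
qed

lemma uniques_insert_old:
  assumes "x \<notin> A" "c x \<in> c ` A"
  shows "uniques c (insert x A) = uniques c A - {c x}"
proof (rule set_eqI)
  fix a
  show "a \<in> uniques c (insert x A) \<longleftrightarrow> a \<in> uniques c A - {c x}"
  proof (cases "a = c x")
    case True
    then show ?thesis using assms by (auto simp: uniques_iff)
  next
    case False
    then have "{u \<in> insert x A. c u = a} = {u \<in> A. c u = a}" by auto
    then show ?thesis using False by (simp add: uniques_def)
  qed
qed

lemma uniques_insert_new:
  assumes "x \<notin> A" "c x \<notin> c ` A"
  shows "uniques c (insert x A) = insert (c x) (uniques c A)"
proof (rule set_eqI)
  fix a
  show "a \<in> uniques c (insert x A) \<longleftrightarrow> a \<in> insert (c x) (uniques c A)"
  proof (cases "a = c x")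
    case True
    then show ?thesis using assms by (auto simp: uniques_iff image_iff)
  next
    case False
    then have "{u \<in> insert x A. c u = a} = {u \<in> A. c u = a}" by auto
    then show ?thesis using False by (simp add: uniques_def)
  qed
qed

lemma uniques_Un_superset:
  assumes "\<And>u. u \<in> A \<Longrightarrow> g u = c u"
  shows "uniques c A - g ` B \<subseteq> uniques g (A \<union> B)"
  using assms by (fastforce simp: uniques_iff image_iff)

lemma mem_uniques_Un:
  assumes "\<And>u. u \<in> A \<Longrightarrow> g u = c u" "x \<in> B" "g x \<notin> c ` A" "\<And>v. v \<in> B \<Longrightarrow> g v = g x \<Longrightarrow> v = x"
  shows "g x \<in> uniques g (A \<union> B)"
  unfolding uniques_iff using assms by (intro bexI[of _ x]) (auto simp: image_iff)

section \<open>List colorings of cycles\<close>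

lemma exists_in_diff:
  assumes "finite B" "card B < card A"
  shows "\<exists>a\<in>A. a \<notin> B"
  using assms by (meson card_mono leD subsetI)

lemma two_elements_in_diff:
  assumes "finite B" "card B + 2 \<le> card A"
  shows "\<exists>a\<in>A. \<exists>b\<in>A. a \<noteq> b \<and> a \<notin> B \<and> b \<notin> B"
proof -
  obtain a where a: "a \<in> A" "a \<notin> B" using exists_in_diff[of B A] assms by auto
  then have "card (insert a B) < card A" using assms by simp
  then obtain b where "b \<in> A" "b \<notin> insert a B" using exists_in_diff[of "insert a B" A] assms by auto
  then show ?thesis using a by blast
qed

text \<open>Greedy coloring by increasing rank: only neighbors of smaller rank count against a list.
  The induction runs over a bound on the ranks, since these may have gaps.\<close>

lemma rank_list_coloring:
  fixes rank :: "'i \<Rightarrow> nat" and M :: "'i \<Rightarrow> nat set"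
  assumes fin: "finite I" and inj: "inj_on rank I"
    and sym: "\<And>i j. adj i j \<Longrightarrow> adj j i" and irr: "\<And>i. \<not> adj i i"
    and room: "\<And>i. i \<in> I \<Longrightarrow> card {j \<in> I. adj i j \<and> rank j < rank i} < card (M i)"
  shows "\<exists>g. \<forall>i\<in>I. g i \<in> M i \<and> (\<forall>j\<in>I. adj i j \<longrightarrow> g i \<noteq> g j)"
proof -
  have "\<exists>g. \<forall>i\<in>I. rank i < n \<longrightarrow> g i \<in> M i \<and> (\<forall>j\<in>I. rank j < n \<longrightarrow> adj i j \<longrightarrow> g i \<noteq> g j)" for n
  proof (induction n)
    case (Suc n)
    then obtain g where g: "\<And>i. i \<in> I \<Longrightarrow> rank i < n \<Longrightarrow> g i \<in> M i"
      "\<And>i j. i \<in> I \<Longrightarrow> j \<in> I \<Longrightarrow> rank i < n \<Longrightarrow> rank j < n \<Longrightarrow> adj i j \<Longrightarrow> g i \<noteq> g j"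
      by blast
    show ?case
    proof (cases "\<exists>k\<in>I. rank k = n")
      case True
      then obtain k where k: "k \<in> I" "rank k = n" by blast
      let ?B = "g ` {j \<in> I. adj k j \<and> rank j < rank k}"
      have "card ?B < card (M k)"
        using room[OF k(1)] card_image_le[of "{j \<in> I. adj k j \<and> rank j < rank k}" g] fin by simp
      then obtain a where a: "a \<in> M k" "a \<notin> ?B" using exists_in_diff[of ?B "M k"] fin by auto
      have other: "rank i < n" if "i \<in> I" "rank i < Suc n" "i \<noteq> k" for i
        using that k inj by (metis inj_onD less_SucE)
      show ?thesis
      proof (intro exI[of _ "g(k := a)"] ballI impI conjI)
        fix i assume i: "i \<in> I" "rank i < Suc n"
        show "(g(k := a)) i \<in> M i" using a g other i by auto
        fix j assume j: "j \<in> I" "rank j < Suc n" "adj i j"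
        have new: "g m \<noteq> a" if "m \<in> I" "rank m < n" "adj k m" for m
          using a that k by auto
        show "(g(k := a)) i \<noteq> (g(k := a)) j"
          using i j g(2)[of i j] other[of i] other[of j] new[of i] new[of j] sym[OF j(3)] irr
          by (cases "i = k"; cases "j = k") auto
      qed
    next
      case False
      then have "rank i < n" if "i \<in> I" "rank i < Suc n" for i
        using that less_antisym by blast
      then show ?thesis using g by blast
    qed
  qed simp
  from this[of "Suc (Max (rank ` I))"] show ?thesis
    using fin by (metis (no_types, lifting) Max_ge finite_imageI imageI less_Suc_eq_le)
qed

section \<open>Cyclic positions and greedy orders on a cycle\<close>

definition csucc :: "nat \<Rightarrow> nat \<Rightarrow> nat" where
  "csucc l i = (if i + 1 = l then 0 else i + 1)"

definition cpred :: "nat \<Rightarrow> nat \<Rightarrow> nat" where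
  "cpred l i = (if i = 0 then l - 1 else i - 1)"

lemma csucc_less: "i < l \<Longrightarrow> csucc l i < l"
  by (auto simp: csucc_def)

lemma cpred_less: "i < l \<Longrightarrow> cpred l i < l"
  by (auto simp: cpred_def)

lemma cpred_csucc: "i < l \<Longrightarrow> cpred l (csucc l i) = i"
  by (auto simp: csucc_def cpred_def)

lemma csucc_cpred: "i < l \<Longrightarrow> csucc l (cpred l i) = i"
  by (auto simp: csucc_def cpred_def)

lemma csucc_neq_cpred: "3 \<le> l \<Longrightarrow> i < l \<Longrightarrow> csucc l i \<noteq> cpred l i"
  by (auto simp: csucc_def cpred_def split: if_splits)

lemma cycle_rank_coloring:
  fixes rank :: "nat \<Rightarrow> nat" and M :: "nat \<Rightarrow> nat set"
  assumes l: "3 \<le> l" and inj: "inj_on rank {..<l}"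
    and room: "\<And>i. i < l \<Longrightarrow> card {j \<in> {cpred l i, csucc l i}. rank j < rank i} < card (M i)"
  shows "\<exists>g. \<forall>i<l. g i \<in> M i \<and> g i \<noteq> g (csucc l i)"
proof -
  define adj where "adj i j \<longleftrightarrow> i < l \<and> j < l \<and> (j = csucc l i \<or> i = csucc l j)" for i j
  have adj_eq: "adj i j \<longleftrightarrow> j \<in> {cpred l i, csucc l i}" if "i < l" for i j
    using that by (auto simp: adj_def csucc_less cpred_less csucc_cpred cpred_csucc)
  have "\<exists>g. \<forall>i\<in>{..<l}. g i \<in> M i \<and> (\<forall>j\<in>{..<l}. adj i j \<longrightarrow> g i \<noteq> g j)"
  proof (rule rank_list_coloring[of _ rank])
    show "adj j i" if "adj i j" for i j using that by (auto simp: adj_def)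
    show "\<not> adj i i" for i using l by (auto simp: adj_def csucc_def split: if_splits)
    show "card {j \<in> {..<l}. adj i j \<and> rank j < rank i} < card (M i)" if "i \<in> {..<l}" for i
    proof -
      have "{j \<in> {..<l}. adj i j \<and> rank j < rank i} = {j \<in> {cpred l i, csucc l i}. rank j < rank i}"
        using that adj_eq[of i] cpred_less csucc_less by auto
      then show ?thesis using room that by simp
    qed
  qed (use inj in auto)
  then obtain g where g: "\<And>i. i < l \<Longrightarrow> g i \<in> M i"
    "\<And>i j. i < l \<Longrightarrow> j < l \<Longrightarrow> adj i j \<Longrightarrow> g i \<noteq> g j" by auto
  have "g i \<noteq> g (csucc l i)" if "i < l" for i
    using g(2)[OF that csucc_less[OF that]] that csucc_less[OF that] by (simp add: adj_def)
  then show ?thesis using g(1) by blast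
qed

text \<open>The order is \<open>l - 1\<close>, \<open>0\<close>, \<open>l - 2\<close>,
  \<open>l - 3\<close>, ..., \<open>1\<close>. Every position after the first has one colored
  neighbor at its turn, except \<open>1\<close>, where the two arcs meet.\<close>

lemma cycle_coloring_1_2_3:
  fixes M :: "nat \<Rightarrow> nat set"
  assumes l: "3 \<le> l" and last: "1 \<le> card (M (l - 1))" and one: "3 \<le> card (M 1)"
    and others: "\<And>i. i < l - 1 \<Longrightarrow> 2 \<le> card (M i)"
  shows "\<exists>g. \<forall>i<l. g i \<in> M i \<and> g i \<noteq> g (csucc l i)"
proof -
  define rank where "rank i = (if i = l - 1 then 0 else if i = 0 then 1 else l - i)" for i
  show ?thesis
  proof (rule cycle_rank_coloring[OF l, of rank])
    show "inj_on rank {..<l}" using l by (auto simp: inj_on_def rank_def split: if_splits)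
    fix i assume i: "i < l"
    let ?E = "{j \<in> {cpred l i, csucc l i}. rank j < rank i}"
    have card_le: "card ?E \<le> 1" if "?E \<subseteq> {b}" for b using card_mono[OF _ that] by simp
    consider "i = l - 1" | "i = 0" | "i = 1" | "2 \<le> i" "i < l - 1" using i by linarith
    then show "card ?E < card (M i)"
    proof cases
      case 1
      then have "?E = {}" by (auto simp: rank_def)
      then have e: "card ?E = 0" by (simp only: card.empty)
      show ?thesis unfolding e using 1 last by simp
    next
      case 2
      have "?E \<subseteq> {l - 1}" using 2 l by (auto simp: rank_def csucc_def cpred_def split: if_splits)
      from card_le[OF this] show ?thesis using others[of 0] l 2 by simp
    next
      case 3
      have "card ?E \<le> card {cpred l i, csucc l i}" by (intro card_mono) auto
      also have "\<dots> \<le> 2" by (simp add: card_insert_if)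
      finally show ?thesis using 3 one by simp
    next
      case 4
      have "?E \<subseteq> {i + 1}" using 4 l by (auto simp: rank_def csucc_def cpred_def split: if_splits)
      from card_le[OF this] show ?thesis using others[of i] 4 by simp
    qed
  qed
qed

text \<open>Positions in \<open>F\<close> come before all others, which follow by increasing index.
  Since \<open>0\<close> is in \<open>F\<close>, the closing edge never joins two unmarked
  positions, so the only earlier unmarked neighbor can be the predecessor.\<close>

lemma cycle_coloring_marked:
  fixes M :: "nat \<Rightarrow> nat set"
  assumes l: "3 \<le> l" and F0: "0 \<in> F"
    and marked: "\<And>i. i < l \<Longrightarrow> i \<in> F \<Longrightarrow> 1 + card ({cpred l i, csucc l i} \<inter> F) \<le> card (M i)"
    and unmarked: "\<And>i. i < l \<Longrightarrow> i \<notin> F \<Longrightarrow> 2 + card ({cpred l i, csucc l i} \<inter> F) \<le> card (M i)"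
  shows "\<exists>g. \<forall>i<l. g i \<in> M i \<and> g i \<noteq> g (csucc l i)"
proof -
  define rank where "rank i = (if i \<in> F then i else l + i)" for i
  show ?thesis
  proof (rule cycle_rank_coloring[OF l, of rank])
    show "inj_on rank {..<l}" by (auto simp: inj_on_def rank_def split: if_splits)
    fix i assume i: "i < l"
    let ?E = "{j \<in> {cpred l i, csucc l i}. rank j < rank i}" and ?F = "{cpred l i, csucc l i} \<inter> F"
    show "card ?E < card (M i)"
    proof (cases "i \<in> F")
      case True
      have "?E \<subseteq> ?F" using i True by (auto simp: rank_def csucc_less cpred_less)
      then have "card ?E \<le> card ?F" by (intro card_mono) auto
      then show ?thesis using marked[OF i True] by simp
    next
      case False
      have "?E \<subseteq> insert (i - 1) ?F" using i False F0
        by (auto simp: rank_def csucc_def cpred_def split: if_splits)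
      then have "card ?E \<le> card (insert (i - 1) ?F)" by (intro card_mono) auto
      also have "\<dots> \<le> card ?F + 1" by (simp add: card_insert_if)
      finally show ?thesis using unmarked[OF i False] by simp
    qed
  qed
qed

section \<open>List colorings in which the two neighbors of a position share a protected color or do
  not both use one\<close>

definition cycle_solution :: "nat \<Rightarrow> (nat \<Rightarrow> nat set) \<Rightarrow> (nat \<Rightarrow> nat set) \<Rightarrow> (nat \<Rightarrow> nat) \<Rightarrow> bool" where
  "cycle_solution l L U g \<longleftrightarrow> (\<forall>i<l. g i \<in> L i \<and> g i \<noteq> g (csucc l i) \<and>
     (g (cpred l i) \<in> U i \<and> g (csucc l i) \<in> U i \<longrightarrow> g (cpred l i) = g (csucc l i)))"

text \<open>Taking \<open>c0\<close> outside \<open>U (l - 1)\<close> and \<open>c1\<close> outside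
  \<open>U 0\<close> settles the two conditions that wrap around; the rest is greedy. A later
  position avoids \<open>c0\<close>, the preceding color and at most \<open>h\<close> colors of one
  set, and \<open>h + 2 < 2 * h + 1\<close> because \<open>h\<close> is at least 2.\<close>

lemma cycle_solution_large:
  assumes l: "3 \<le> l" and h: "2 \<le> h"
    and L: "\<And>i. i < l \<Longrightarrow> 2 * h + 1 \<le> card (L i)"
    and U: "\<And>i. i < l \<Longrightarrow> finite (U i) \<and> card (U i) = h + 1"
  shows "\<exists>g. cycle_solution l L U g"
proof -
  have "card (U (l - 1)) < card (L 0)" using L[of 0] U[of "l - 1"] l h by simp
  then obtain c0 where c0: "c0 \<in> L 0" "c0 \<notin> U (l - 1)"
    using exists_in_diff[of "U (l - 1)" "L 0"] U[of "l - 1"] l by auto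
  have "card (insert c0 (U 0)) \<le> h + 2" using U[of 0] l by (simp add: card_insert_if)
  also have "\<dots> < card (L 1)" using L[of 1] l h by simp
  finally obtain c1 where c1: "c1 \<in> L 1" "c1 \<notin> insert c0 (U 0)"
    using exists_in_diff[of "insert c0 (U 0)" "L 1"] U[of 0] l by auto
  \<comment> \<open>Avoiding \<open>c0\<close> at every later position makes the closing edge
    proper.\<close>
  have "\<exists>g. g 0 = c0 \<and> g 1 = c1 \<and> (\<forall>i. 2 \<le> i \<and> i < n \<longrightarrow> g i \<in> L i \<and> g i \<noteq> c0 \<and> g i \<noteq> g (i - 1) \<and>
      (g (i - 2) \<in> U (i - 1) \<and> g i \<in> U (i - 1) \<longrightarrow> g (i - 2) = g i))" if "n \<le> l" for n
    using that
  proof (induction n)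
    case 0
    show ?case by (intro exI[of _ "\<lambda>i. if i = 0 then c0 else c1"]) auto
  next
    case (Suc n)
    then obtain g where g: "g 0 = c0" "g 1 = c1" "\<And>i. 2 \<le> i \<Longrightarrow> i < n \<Longrightarrow> g i \<in> L i \<and> g i \<noteq> c0 \<and>
        g i \<noteq> g (i - 1) \<and> (g (i - 2) \<in> U (i - 1) \<and> g i \<in> U (i - 1) \<longrightarrow> g (i - 2) = g i)" by auto
    show ?case
    proof (cases "2 \<le> n")
      case True
      define B where "B = (if g (n - 2) \<in> U (n - 1) then U (n - 1) - {g (n - 2)} else {})"
      have "finite B" "card B \<le> h" using U[of "n - 1"] Suc.prems by (auto simp: B_def)
      then have "card (insert c0 (insert (g (n - 1)) B)) \<le> h + 2" by (simp add: card_insert_if)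
      also have "\<dots> < card (L n)" using L[of n] Suc.prems h by simp
      finally obtain a where a: "a \<in> L n" "a \<notin> insert c0 (insert (g (n - 1)) B)"
        using exists_in_diff[of "insert c0 (insert (g (n - 1)) B)" "L n"] \<open>finite B\<close> by auto
      have "g (n - 2) \<in> U (n - 1) \<and> a \<in> U (n - 1) \<longrightarrow> g (n - 2) = a"
        using a by (auto simp: B_def split: if_splits)
      let ?g = "g(n := a)"
      have "?g i \<in> L i \<and> ?g i \<noteq> c0 \<and> ?g i \<noteq> ?g (i - 1) \<and>
          (?g (i - 2) \<in> U (i - 1) \<and> ?g i \<in> U (i - 1) \<longrightarrow> ?g (i - 2) = ?g i)"
        if i: "2 \<le> i" "i < Suc n" for i
      proof (cases "i = n")
        case True
        then have "n - 1 \<noteq> n" "n - 2 \<noteq> n" using i by auto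
        then show ?thesis using True a \<open>g (n - 2) \<in> U (n - 1) \<and> a \<in> U (n - 1) \<longrightarrow> g (n - 2) = a\<close> by simp
      next
        case False
        then have "i \<noteq> n" "i - 1 \<noteq> n" "i - 2 \<noteq> n" "i < n" using i by auto
        then show ?thesis using g(3)[OF i(1)] by simp
      qed
      moreover have "?g 0 = c0" "?g 1 = c1" using g True by auto
      ultimately show ?thesis by blast
    next
      case False
      then show ?thesis using g by (intro exI[of _ g]) auto
    qed
  qed
  then obtain g where g: "g 0 = c0" "g 1 = c1" "\<And>i. 2 \<le> i \<Longrightarrow> i < l \<Longrightarrow> g i \<in> L i \<and> g i \<noteq> c0 \<and>
      g i \<noteq> g (i - 1) \<and> (g (i - 2) \<in> U (i - 1) \<and> g i \<in> U (i - 1) \<longrightarrow> g (i - 2) = g i)" by blast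
  have "g i \<in> L i \<and> g i \<noteq> g (csucc l i) \<and>
     (g (cpred l i) \<in> U i \<and> g (csucc l i) \<in> U i \<longrightarrow> g (cpred l i) = g (csucc l i))" if i: "i < l" for i
  proof -
    have "g i \<in> L i" using g c0 c1 i by (cases "i = 0"; cases "i = 1") auto
    moreover have "g i \<noteq> g (csucc l i)"
    proof (cases "i + 1 = l")
      case True
      then show ?thesis using g(1) g(3)[of i] l by (auto simp: csucc_def)
    next
      case False
      then show ?thesis using g(1,2) g(3)[of "i + 1"] c1 i by (cases "i = 0") (auto simp: csucc_def)
    qed
    moreover have "g (cpred l i) \<in> U i \<and> g (csucc l i) \<in> U i \<longrightarrow> g (cpred l i) = g (csucc l i)"
    proof -
      consider "i = 0" | "i = l - 1" | "1 \<le> i" "i + 1 < l" using i by linarith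
      then show ?thesis
      proof cases
        case 1
        then show ?thesis using c1 g l by (auto simp: csucc_def)
      next
        case 2
        then show ?thesis using c0 g l by (auto simp: csucc_def)
      next
        case 3
        then show ?thesis using g(3)[of "i + 1"] by (auto simp: csucc_def cpred_def)
      qed
    qed
    ultimately show ?thesis by blast
  qed
  then show ?thesis by (auto simp: cycle_solution_def)
qed

text \<open>If a color of \<open>U i\<close> is missing from one of the neighboring lists, at most
  one pair of colors violates the condition at \<open>i\<close>, and forbidding one color at either
  neighbor excludes it. The successor gives up this color, but for position \<open>0\<close> the
  predecessor does. So \<open>l - 1\<close> loses two colors, \<open>1\<close> none and every other
  position one.\<close>

lemma cycle_solution_simple:
  assumes l: "3 \<le> l"
    and L: "\<And>i. i < l \<Longrightarrow> 3 \<le> card (L i)"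
    and U: "\<And>i. i < l \<Longrightarrow> card (U i) = 2"
    and simple: "\<And>i. i < l \<Longrightarrow> \<not> (U i \<subseteq> L (cpred l i) \<and> U i \<subseteq> L (csucc l i))"
  shows "\<exists>g. cycle_solution l L U g"
proof -
  have two: "\<exists>f. \<forall>x\<in>P. \<forall>y\<in>Q. y \<noteq> f \<longrightarrow> x \<in> W \<and> y \<in> W \<longrightarrow> x = y"
    if W: "card W = 2" "\<not> (W \<subseteq> P \<and> W \<subseteq> Q)" for P Q W :: "nat set"
  proof -
    obtain a b where ab: "W = {a, b}" "a \<noteq> b" using W(1) by (auto simp: card_2_iff)
    show ?thesis using W(2) ab by auto
  qed
  have "\<exists>f. \<forall>x\<in>L (cpred l i). \<forall>y\<in>L (csucc l i). y \<noteq> f \<longrightarrow> x \<in> U i \<and> y \<in> U i \<longrightarrow> x = y" if "i < l" for i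
    using two[of "U i" "L (cpred l i)" "L (csucc l i)"] U[OF that] simple[OF that] by blast
  then obtain f where f: "\<And>i x y. i < l \<Longrightarrow> x \<in> L (cpred l i) \<Longrightarrow> y \<in> L (csucc l i) \<Longrightarrow> y \<noteq> f i \<Longrightarrow>
      x \<in> U i \<Longrightarrow> y \<in> U i \<Longrightarrow> x = y" by metis
  have "\<exists>b. \<forall>y\<in>L (csucc l 0). \<forall>x\<in>L (cpred l 0). x \<noteq> b \<longrightarrow> y \<in> U 0 \<and> x \<in> U 0 \<longrightarrow> y = x"
    using two[of "U 0" "L (csucc l 0)" "L (cpred l 0)"] U[of 0] simple[of 0] l by fastforce
  then obtain b where b: "\<And>x y. y \<in> L (csucc l 0) \<Longrightarrow> x \<in> L (cpred l 0) \<Longrightarrow> x \<noteq> b \<Longrightarrow>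
      y \<in> U 0 \<Longrightarrow> x \<in> U 0 \<Longrightarrow> y = x" by blast
  define M where "M i = (if i = 1 then L 1 else if i = l - 1 then L i - {f (l - 2), b}
      else L i - {f (cpred l i)})" for i
  have M_L: "M i \<subseteq> L i" for i by (auto simp: M_def)
  have "\<exists>g. \<forall>i<l. g i \<in> M i \<and> g i \<noteq> g (csucc l i)"
  proof (rule cycle_coloring_1_2_3[OF l])
    have "card (L (l - 1)) - card {f (l - 2), b} \<le> card (L (l - 1) - {f (l - 2), b})"
      by (intro diff_card_le_card_Diff) simp
    moreover have "card {f (l - 2), b} \<le> 2" by (simp add: card_insert_if)
    ultimately have "1 \<le> card (L (l - 1) - {f (l - 2), b})" using L[of "l - 1"] l by linarith
    then show "1 \<le> card (M (l - 1))" using l by (auto simp: M_def)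
    show "3 \<le> card (M 1)" using L[of 1] l by (simp add: M_def)
    fix i assume i: "i < l - 1"
    have "card (L i) - 1 \<le> card (L i - {f (cpred l i)})" by (simp add: card_Diff_singleton_if)
    then have "2 \<le> card (L i - {f (cpred l i)})" "2 \<le> card (L i)" using L[of i] i by linarith+
    then show "2 \<le> card (M i)" using i by (auto simp: M_def)
  qed
  then obtain g where g: "\<And>i. i < l \<Longrightarrow> g i \<in> M i" "\<And>i. i < l \<Longrightarrow> g i \<noteq> g (csucc l i)" by blast
  have gL: "g i \<in> L i" if "i < l" for i using g(1)[OF that] M_L by blast
  have "g (cpred l i) = g (csucc l i)"
    if i: "i < l" and U: "g (cpred l i) \<in> U i" "g (csucc l i) \<in> U i" for i
  proof (cases "i = 0")
    case True
    then have "g (cpred l i) \<noteq> b" using g(1)[of "l - 1"] l by (auto simp: M_def cpred_def split: if_splits)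
    then show ?thesis using b[of "g (csucc l i)" "g (cpred l i)"] U i gL csucc_less cpred_less True
      by metis
  next
    case False
    have "csucc l i \<noteq> 1" using False by (simp add: csucc_def)
    moreover have "i = l - 2" if "csucc l i = l - 1"
      using that l i by (simp add: csucc_def split: if_splits)
    ultimately have "g (csucc l i) \<noteq> f i"
      using g(1)[OF csucc_less[OF i]] cpred_csucc[OF i]
      by (cases "csucc l i = l - 1") (simp_all add: M_def)
    then show ?thesis using f[OF i] gL[OF cpred_less[OF i]] gL[OF csucc_less[OF i]] U by blast
  qed
  then have "cycle_solution l L U g" using g gL by (simp add: cycle_solution_def)
  then show ?thesis by blast
qed

section \<open>Pairs of protected colors contained in both neighboring lists\<close>

definition conflict :: "nat \<Rightarrow> nat set \<Rightarrow> nat set" where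
  "conflict a W = (if a \<in> W then W - {a} else {})"

lemma conflict_subset: "conflict a W \<subseteq> W"
  by (auto simp: conflict_def)

lemma card_conflict:
  assumes "card W = 2"
  shows "finite (conflict a W)" "card (conflict a W) \<le> 1"
  using assms card_ge_0_finite[of W] by (auto simp: conflict_def)

lemma not_conflict: "b \<notin> conflict a W \<Longrightarrow> a \<in> W \<and> b \<in> W \<longrightarrow> a = b"
  by (auto simp: conflict_def split: if_splits)

context
  fixes l :: nat and L U :: "nat \<Rightarrow> nat set"
  assumes L: "\<And>i. i < l \<Longrightarrow> 3 \<le> card (L i)"
    and U: "\<And>i. i < l \<Longrightarrow> card (U i) = 2"
    and disj: "\<And>i. i < l \<Longrightarrow> L i \<inter> U i = {}"
begin

text \<open>Position \<open>1\<close> takes some \<open>v\<close> from \<open>U 0\<close>, and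
  position \<open>2\<close> a color outside \<open>U 0\<close>. If an element of \<open>U 0\<close>
  excludes a color of \<open>L 0\<close> through \<open>U 2\<close>, then \<open>U 2\<close>
  consists of these two and misses the other element of \<open>U 0\<close>. So some \<open>v\<close>
  costs position \<open>0\<close> nothing, which leaves it at most two exclusions.\<close>

lemma cycle_solution_crossing_triangle:
  assumes l: "l = 3" and cross: "U 0 \<subseteq> L 1" "U 0 \<subseteq> L 2"
  shows "\<exists>g. cycle_solution l L U g"
proof -
  obtain u u' where u: "U 0 = {u, u'}" "u \<noteq> u'" using U[of 0] l by (auto simp: card_2_iff)
  have "\<exists>v\<in>U 0. conflict v (U 2) \<inter> L 0 = {}"
  proof (cases "conflict u (U 2) \<inter> L 0 = {}")
    case False
    then obtain e where e: "e \<in> U 2" "e \<noteq> u" "e \<in> L 0" "u \<in> U 2" by (auto simp: conflict_def split: if_splits)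
    have "U 2 = {u, e}"
      using e U[of 2] l card_ge_0_finite[of "U 2"] card_seteq[of "U 2" "{u, e}"] by simp
    moreover have "e \<noteq> u'" using e u disj[of 0] l by auto
    ultimately have "conflict u' (U 2) = {}" using u by (auto simp: conflict_def)
    then show ?thesis using u by auto
  qed (use u in auto)
  then obtain v where v: "v \<in> U 0" "conflict v (U 2) \<inter> L 0 = {}" by blast
  obtain y where y: "y \<in> L 2" "y \<notin> U 0"
    using exists_in_diff[of "U 0" "L 2"] U[of 0] L[of 2] l card_ge_0_finite[of "U 0"] by auto
  have c1: "finite (conflict y (U 1))" "card (conflict y (U 1)) \<le> 1" using card_conflict U[of 1] l by auto
  then have "card (insert y (conflict y (U 1))) < card (L 0)"
    using L[of 0] l by (simp add: card_insert_if)
  then obtain z where z: "z \<in> L 0" "z \<notin> insert y (conflict y (U 1))"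
    using exists_in_diff[of "insert y (conflict y (U 1))" "L 0"] c1 by auto
  define g where "g i = (if i = 0 then z else if i = 1 then v else y)" for i :: nat
  have zv: "z \<noteq> v" using z v disj[of 0] l by auto
  have "v \<noteq> y" using v y by auto
  have z1: "z \<in> U 1 \<and> y \<in> U 1 \<longrightarrow> z = y" using not_conflict[of z y "U 1"] z by auto
  have z2: "\<not> (v \<in> U 2 \<and> z \<in> U 2)" using v(2) z(1) zv by (auto simp: conflict_def)
  have "g i \<in> L i \<and> g i \<noteq> g (csucc l i) \<and>
     (g (cpred l i) \<in> U i \<and> g (csucc l i) \<in> U i \<longrightarrow> g (cpred l i) = g (csucc l i))" if i: "i < l" for i
  proof -
    consider "i = 0" | "i = 1" | "i = 2" using i l by linarith
    then show ?thesis
      by cases (use z zv y v cross z1 z2 \<open>v \<noteq> y\<close> l in \<open>auto simp: g_def csucc_def cpred_def\<close>)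
  qed
  then show ?thesis by (auto simp: cycle_solution_def)
qed

text \<open>A search along the cycle with a color fixed in advance at position \<open>1\<close>; the
  condition at \<open>n\<close> stays open until \<open>n + 1\<close> is colored.\<close>

definition partial_solution :: "nat \<Rightarrow> nat \<Rightarrow> (nat \<Rightarrow> nat) \<Rightarrow> bool" where
  "partial_solution u n g \<longleftrightarrow> g 1 = u \<and> (\<forall>i. 2 \<le> i \<and> i \<le> n \<longrightarrow> g i \<in> L i \<and> g i \<noteq> g (i - 1)) \<and>
     (\<forall>i. 2 \<le> i \<and> i < n \<longrightarrow> g (i - 1) \<in> U i \<and> g (i + 1) \<in> U i \<longrightarrow> g (i - 1) = g (i + 1))"

lemma partial_solution_extend:
  assumes g: "partial_solution u n g" and n: "2 \<le> n"
    and z: "z \<in> L (n + 1)" "z \<noteq> g n" "z \<notin> conflict (g (n - 1)) (U n)"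
  shows "partial_solution u (n + 1) (g(n + 1 := z))"
proof -
  let ?g = "g(n + 1 := z)"
  have "?g i \<in> L i \<and> ?g i \<noteq> ?g (i - 1)" if "2 \<le> i" "i \<le> n + 1" for i
    using that g z unfolding partial_solution_def by (cases "i = n + 1") auto
  moreover have "?g (i - 1) \<in> U i \<and> ?g (i + 1) \<in> U i \<longrightarrow> ?g (i - 1) = ?g (i + 1)"
    if "2 \<le> i" "i < n + 1" for i
  proof (cases "i = n")
    case True
    then show ?thesis using not_conflict[OF z(3)] n by simp
  next
    case False
    then show ?thesis using that g unfolding partial_solution_def by auto
  qed
  moreover have "?g 1 = u" using g n by (auto simp: partial_solution_def)
  ultimately show ?thesis by (simp add: partial_solution_def)
qed

text \<open>
  A color available at position \<open>n\<close> is never excluded at position \<open>n + 1\<close> by the pair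
  \<^term>\<open>U n\<close>, because \<^term>\<open>L n\<close> and \<^term>\<open>U n\<close> are disjoint. Hence two
  partial solutions with different last colors always leave a choice at the next position,
  even if one further color is forbidden there.
\<close>

lemma extension_choice:
  assumes n: "2 \<le> n" "n + 1 < l" and g: "partial_solution u n g" "partial_solution u n g'" "g n \<noteq> g' n"
  shows "\<exists>f\<in>{g, g'}. \<exists>z. z \<noteq> s \<and> z \<in> L (n + 1) \<and> z \<noteq> f n \<and> z \<notin> conflict (f (n - 1)) (U n)"
proof -
  have c: "finite (conflict a (U n))" "card (conflict a (U n)) \<le> 1" for a
    using card_conflict U[of n] n by auto
  have in_L: "g' n \<in> L n" using g n by (auto simp: partial_solution_def)
  show ?thesis
  proof (cases "g' n \<in> L (n + 1) \<and> g' n \<noteq> s")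
    case True
    have "g' n \<notin> U n" using in_L disj[of n] n by auto
    then have "g' n \<notin> conflict (g (n - 1)) (U n)" using conflict_subset by blast
    then show ?thesis using True g(3) by (intro bexI[of _ g] exI[of _ "g' n"]) auto
  next
    case False
    let ?B = "conflict (g' (n - 1)) (U n)"
    have "\<exists>z\<in>L (n + 1). z \<notin> insert s (insert (g' n) ?B)"
    proof (cases "g' n = s")
      case True
      have "card (insert s ?B) \<le> 2" using c[of "g' (n - 1)"] by (simp add: card_insert_if)
      then have "card (insert s ?B) < card (L (n + 1))" using L[of "n + 1"] n by simp
      then show ?thesis using exists_in_diff[of "insert s ?B" "L (n + 1)"] c True by auto
    next
      case neq: False
      have "card (insert s ?B) \<le> 2" using c[of "g' (n - 1)"] by (simp add: card_insert_if)
      then have "card (insert s ?B) < card (L (n + 1))" using L[of "n + 1"] n by simp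
      then obtain z where "z \<in> L (n + 1)" "z \<notin> insert s ?B"
        using exists_in_diff[of "insert s ?B" "L (n + 1)"] c by auto
      then show ?thesis using False neq by auto
    qed
    then show ?thesis by blast
  qed
qed

lemma two_partial_solutions:
  assumes "2 \<le> n" "n < l"
  shows "\<exists>g g'. partial_solution u n g \<and> partial_solution u n g' \<and> g n \<noteq> g' n"
  using assms
proof (induction n rule: nat_induct_at_least)
  case base
  obtain a b where ab: "a \<in> L 2" "b \<in> L 2" "a \<noteq> b" "a \<notin> {u}" "b \<notin> {u}"
    using two_elements_in_diff[of "{u}" "L 2"] L[of 2] base by auto
  have "partial_solution u 2 (\<lambda>i. if i = 2 then c else u)" if "c \<in> L 2" "c \<noteq> u" for c
    unfolding partial_solution_def
  proof (intro conjI allI impI)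
    fix i :: nat assume "2 \<le> i \<and> i \<le> 2"
    then have "i = 2" by simp
    then show "(if i = 2 then c else u) \<in> L i" "(if i = 2 then c else u) \<noteq> (if i - 1 = 2 then c else u)"
      using that by auto
  qed auto
  then show ?case using ab
    by - (rule exI[of _ "\<lambda>i. if i = 2 then a else u"],
      rule exI[of _ "\<lambda>i. if i = 2 then b else u"], auto)
next
  case (Suc n)
  then obtain g g' where g: "partial_solution u n g" "partial_solution u n g'" "g n \<noteq> g' n" by auto
  have n: "2 \<le> n" "n + 1 < l" using Suc by auto
  have ext: "partial_solution u (Suc n) (f(n + 1 := z))"
    if "f \<in> {g, g'}" "z \<in> L (n + 1)" "z \<noteq> f n" "z \<notin> conflict (f (n - 1)) (U n)" for f z
    using partial_solution_extend[of u n f z] that g n by auto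
  obtain f z where f: "f \<in> {g, g'}" "z \<in> L (n + 1)" "z \<noteq> f n" "z \<notin> conflict (f (n - 1)) (U n)"
    using extension_choice[OF n g, of u] by blast
  \<comment> \<open>Forbidding the color \<open>z\<close> just found makes the two extensions end
    differently.\<close>
  obtain f' z' where f': "f' \<in> {g, g'}" "z' \<noteq> z" "z' \<in> L (n + 1)" "z' \<noteq> f' n"
    "z' \<notin> conflict (f' (n - 1)) (U n)"
    using extension_choice[OF n g, of z] by blast
  have "(f(n + 1 := z)) (Suc n) \<noteq> (f'(n + 1 := z')) (Suc n)" using f'(2) by simp
  then show ?case using ext[OF f] ext[OF f'(1,3,4,5)] by blast
qed

text \<open>Both neighbors of position \<open>0\<close> get the same \<open>u\<close> from
  \<open>U 0\<close>: this meets the condition at \<open>0\<close>, and \<open>u\<close> is not in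
  \<open>L 0\<close>. Position \<open>0\<close>, colored last, then avoids at most two colors, one
  each for \<open>U 1\<close> and \<open>U (l - 1)\<close>. In between, the search must reach
  \<open>l - 2\<close> compatibly with \<open>u\<close> at \<open>l - 1\<close>. On a triangle
  positions \<open>1\<close> and \<open>l - 1\<close> are adjacent, so that case is
  separate.\<close>

lemma cycle_solution_crossing:
  assumes l: "3 \<le> l" and cross: "U 0 \<subseteq> L 1" "U 0 \<subseteq> L (l - 1)"
  shows "\<exists>g. cycle_solution l L U g"
proof (cases "l = 3")
  case True
  then show ?thesis using cycle_solution_crossing_triangle cross by simp
next
  case False
  then have l4: "4 \<le> l" using l by simp
  obtain u u' where u: "U 0 = {u, u'}" "u \<noteq> u'" using U[of 0] l by (auto simp: card_2_iff)
  have u0: "u \<notin> L 0" using u disj[of 0] l by auto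
  have "\<exists>g. partial_solution u (l - 2) g \<and> g (l - 2) \<noteq> u \<and>
      (g (l - 3) \<in> U (l - 2) \<and> u \<in> U (l - 2) \<longrightarrow> g (l - 3) = u)"
  proof (cases "l = 4")
    case True
    \<comment> \<open>Position \<open>l - 3\<close> is position \<open>1\<close> here and carries
      \<open>u\<close> itself.\<close>
    obtain g g' where g: "partial_solution u 2 g" "partial_solution u 2 g'" "g 2 \<noteq> g' 2"
      using two_partial_solutions[of 2 u] l4 by auto
    then have "f 2 \<noteq> u \<and> f 1 = u" if "f \<in> {g, g'}" for f using that by (auto simp: partial_solution_def)
    then show ?thesis using g True by (intro exI[of _ g]) auto
  next
    case False
    define n where "n = l - 3"
    have n: "2 \<le> n" "n + 1 < l" "n + 1 = l - 2" using l4 False by (auto simp: n_def)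
    obtain g g' where g: "partial_solution u n g" "partial_solution u n g'" "g n \<noteq> g' n"
      using two_partial_solutions[of n u] n by auto
    have ext: "\<exists>g. partial_solution u (l - 2) g \<and> g (l - 2) \<noteq> u \<and>
        (g (l - 3) \<in> U (l - 2) \<and> u \<in> U (l - 2) \<longrightarrow> g (l - 3) = u)"
      if "f \<in> {g, g'}" "z \<noteq> u" "z \<in> L (n + 1)" "z \<noteq> f n" "z \<notin> conflict (f (n - 1)) (U n)"
        "f n \<in> U (l - 2) \<and> u \<in> U (l - 2) \<longrightarrow> f n = u" for f z
      using partial_solution_extend[of u n f z] that g n
      by (intro exI[of _ "f(n + 1 := z)"]) (auto simp: n_def)
    show ?thesis
    proof (cases "u \<in> U (l - 2)")
      case False
      then show ?thesis using extension_choice[OF n(1,2) g, of u] ext by blast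
    next
      case True
      \<comment> \<open>Now \<open>u\<close> is no choice at \<open>l - 2\<close> anyway, so the
        freedom is spent one position earlier: one of the two partial solutions does not end in the
        partner \<open>e\<close> of \<open>u\<close> in \<open>U (l - 2)\<close>.\<close>
      then have uL: "u \<notin> L (n + 1)" using disj[of "n + 1"] n by auto
      obtain a b where "U (l - 2) = {a, b}" using U[of "l - 2"] l by (auto simp: card_2_iff)
      then have "U (l - 2) = {u, a} \<or> U (l - 2) = {u, b}" using True by auto
      then obtain e where e: "U (l - 2) = {u, e}" by blast
      obtain f where f: "f \<in> {g, g'}" "f n \<noteq> e" using g(3) by auto
      let ?B = "insert (f n) (conflict (f (n - 1)) (U n))"
      have c: "finite (conflict (f (n - 1)) (U n))" "card (conflict (f (n - 1)) (U n)) \<le> 1"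
        using card_conflict U[of n] n by auto
      then have "card ?B < card (L (n + 1))" using L[of "n + 1"] n by (simp add: card_insert_if)
      then obtain z where "z \<in> L (n + 1)" "z \<notin> ?B" using exists_in_diff[of ?B "L (n + 1)"] c by auto
      then show ?thesis using ext[of f z] f uL e by auto
    qed
  qed
  then obtain g where g: "partial_solution u (l - 2) g" "g (l - 2) \<noteq> u"
    "g (l - 3) \<in> U (l - 2) \<and> u \<in> U (l - 2) \<longrightarrow> g (l - 3) = u" by blast
  let ?B = "conflict (g 2) (U 1) \<union> conflict (g (l - 2)) (U (l - 1))"
  have c: "finite ?B" "card ?B \<le> 2"
    using card_conflict[of "U 1" "g 2"] card_conflict[of "U (l - 1)" "g (l - 2)"] U[of 1] U[of "l - 1"] l
      card_Un_le[of "conflict (g 2) (U 1)" "conflict (g (l - 2)) (U (l - 1))"] by auto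
  then obtain z where z: "z \<in> L 0" "z \<notin> ?B"
    using exists_in_diff[of ?B "L 0"] L[of 0] l by auto
  define f where "f i = (if i = 0 then z else if i = l - 1 then u else g i)" for i
  have f1: "f 1 = u" using g(1) l4 by (auto simp: f_def partial_solution_def)
  have f0: "f 0 = z" "f (l - 1) = u" using l4 by (auto simp: f_def)
  have fi: "f i = g i" if "1 \<le> i" "i \<le> l - 2" for i using that l4 by (auto simp: f_def)
  have zu: "z \<noteq> u" using z u0 by auto
  have gL: "g i \<in> L i" "g i \<noteq> g (i - 1)" if "2 \<le> i" "i \<le> l - 2" for i
    using g(1) that by (auto simp: partial_solution_def)
  have gU: "g (i - 1) \<in> U i \<and> g (i + 1) \<in> U i \<longrightarrow> g (i - 1) = g (i + 1)" if "2 \<le> i" "i < l - 2" for i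
    using g(1) that by (auto simp: partial_solution_def)
  have "f i \<in> L i \<and> f i \<noteq> f (csucc l i) \<and>
     (f (cpred l i) \<in> U i \<and> f (csucc l i) \<in> U i \<longrightarrow> f (cpred l i) = f (csucc l i))" if i: "i < l" for i
  proof -
    consider "i = 0" | "i = 1" | "2 \<le> i" "i < l - 2" | "i = l - 2" "2 \<le> i" | "i = l - 1" using i by linarith
    then show ?thesis
    proof cases
      case 1
      then have "csucc l i = 1" "cpred l i = l - 1" using l4 by (auto simp: csucc_def cpred_def)
      then show ?thesis using 1 f0 f1 zu z by simp
    next
      case 2
      then have e: "csucc l i = 2" "cpred l i = 0" using l4 by (auto simp: csucc_def cpred_def)
      have f2: "f 2 = g 2" using fi[of 2] l4 by simp
      have "g 2 \<noteq> g 1" "g 1 = u" using gL[of 2] l4 g(1) by (auto simp: partial_solution_def)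
      then show ?thesis using 2 e f0 f1 f2 cross u not_conflict[of z "g 2" "U 1"] z by auto
    next
      case 3
      then have e: "csucc l i = i + 1" "cpred l i = i - 1" using l4 by (auto simp: csucc_def cpred_def)
      have "f i = g i" "f (i + 1) = g (i + 1)" "f (i - 1) = g (i - 1)" using 3 fi by auto
      then show ?thesis using e gL[of i] gL[of "i + 1"] gU[of i] 3 by auto
    next
      case 4
      then have e: "csucc l i = l - 1" "cpred l i = l - 3" using l4 by (auto simp: csucc_def cpred_def)
      have "f i = g i" "f (l - 3) = g (l - 3)" using 4 fi l4 by auto
      then show ?thesis using e gL[of i] g f0 4 by auto
    next
      case 5
      then have e: "csucc l i = 0" "cpred l i = l - 2" using l4 by (auto simp: csucc_def cpred_def)
      have "f (l - 2) = g (l - 2)" using fi[of "l - 2"] l4 by simp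
      then show ?thesis using 5 e f0 cross u zu not_conflict[of z "g (l - 2)" "U (l - 1)"] z by auto
    qed
  qed
  then show ?thesis by (auto simp: cycle_solution_def)
qed

end

section \<open>Rotating a cycle\<close>

lemma csucc_shift:
  assumes "0 < l"
  shows "csucc l ((i + m) mod l) = (csucc l (i mod l) + m) mod l"
proof -
  have "csucc l (j mod l) = Suc j mod l" for j
    using assms by (simp add: csucc_def mod_Suc)
  then show ?thesis by (metis add_Suc mod_add_left_eq)
qed

text \<open>Lets a distinguished position be moved to a fixed one. The condition is local, so a
  solution of the rotated problem is carried back by \<open>k\<close>, the inverse of adding
  \<open>m\<close>.\<close>

lemma cycle_shift:
  assumes m: "m < l"
    and ex: "\<exists>g. \<forall>i<l. Q ((i + m) mod l) (g (cpred l i)) (g i) (g (csucc l i))"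
  shows "\<exists>g. \<forall>i<l. Q i (g (cpred l i)) (g i) (g (csucc l i))"
proof -
  obtain g where g: "\<And>i. i < l \<Longrightarrow> Q ((i + m) mod l) (g (cpred l i)) (g i) (g (csucc l i))"
    using ex by blast
  define k where "k i = (i + (l - m)) mod l" for i
  have l: "0 < l" using m by simp
  have k_less: "k i < l" for i using l by (simp add: k_def)
  have k_inv: "(k i + m) mod l = i" if "i < l" for i
    using that m by (simp add: k_def mod_add_left_eq)
  have k_succ: "k (csucc l i) = csucc l (k i)" if "i < l" for i
    using csucc_shift[OF l, of i "l - m"] that by (simp add: k_def)
  have k_pred: "k (cpred l i) = cpred l (k i)" if "i < l" for i
    using k_succ[OF cpred_less[OF that]] csucc_cpred[OF that] cpred_csucc[OF k_less] by metis
  show ?thesis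
  proof (intro exI[of _ "\<lambda>i. g (k i)"] allI impI)
    fix i assume i: "i < l"
    show "Q i (g (k (cpred l i))) (g (k i)) (g (k (csucc l i)))"
      using g[OF k_less[of i]] k_inv[OF i] k_succ[OF i] k_pred[OF i] by simp
  qed
qed

section \<open>Completing a coloring along a cycle\<close>

lemma card_Diff_Diff_ge:
  assumes "finite A" "finite B"
  shows "card L \<le> card (L - A - B) + card A + card B"
  using diff_card_le_card_Diff[OF assms(1), of L] diff_card_le_card_Diff[OF assms(2), of "L - A"]
  by linarith

text \<open>
  The colors of the uncolored vertices of a cycle: \<open>L i\<close> lists the colors available at the
  \<open>i\<close>-th vertex, \<open>C i\<close> are the colors of its \<open>D - 2\<close> neighbors outside the cycle and
  \<open>U i\<close> those among them that occur only once.
\<close>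

locale cycle_lists =
  fixes l h D :: nat and L C U :: "nat \<Rightarrow> nat set"
  assumes l: "3 \<le> l" and h: "1 \<le> h" and D: "h + 2 \<le> D"
    and fin_C: "\<And>i. i < l \<Longrightarrow> finite (C i)"
    and U_C: "\<And>i. i < l \<Longrightarrow> U i \<subseteq> C i"
    and card_C: "\<And>i. i < l \<Longrightarrow> card (C i) \<le> D - 2"
    and card_U: "\<And>i. i < l \<Longrightarrow> h \<le> card (U i)"
    and U_eq: "\<And>i. i < l \<Longrightarrow> card (C i) = D - 2 \<Longrightarrow> U i = C i"
    and U_less: "\<And>i. i < l \<Longrightarrow> card (C i) < D - 2 \<Longrightarrow> card (U i) < card (C i)"
    and C_U: "\<And>i. i < l \<Longrightarrow> 2 * card (C i) \<le> D - 2 + card (U i)"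
    and L_C: "\<And>i. i < l \<Longrightarrow> L i \<inter> C i = {}"
    and card_L: "\<And>i. i < l \<Longrightarrow> D - 1 + 2 * h \<le> card (L i) + card (C i)"
begin

text \<open>Here \<open>x\<close> and \<open>y\<close> are the colors of the two cycle neighbors. A
  color outside \<open>C i\<close> is as good as sparing \<open>h\<close> colors of
  \<open>U i\<close>: if both neighbors share it, nothing is lost; otherwise it becomes unique and
  makes up for the one color that the other neighbor may destroy. Properness toward \<open>y\<close>
  suffices because it is demanded all around the cycle.\<close>

definition good :: "nat \<Rightarrow> nat \<Rightarrow> nat \<Rightarrow> nat \<Rightarrow> bool" where
  "good i x a y \<longleftrightarrow> a \<in> L i \<and> a \<noteq> y \<and> (h \<le> card (U i - {x, y}) \<or> x \<notin> C i \<or> y \<notin> C i)"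

lemma fin_U: "i < l \<Longrightarrow> finite (U i)"
  using fin_C U_C finite_subset by blast

lemma shifted: "cycle_lists l h D (\<lambda>i. L ((i + m) mod l)) (\<lambda>i. C ((i + m) mod l)) (\<lambda>i. U ((i + m) mod l))"
proof -
  have less: "(i + m) mod l < l" for i using l by simp
  show ?thesis
    by (rule cycle_lists.intro)
      (rule l h D fin_C[OF less] U_C[OF less] card_C[OF less] card_U[OF less] U_eq[OF less]
        U_less[OF less] C_U[OF less] L_C[OF less] card_L[OF less]; assumption)+
qed

text \<open>Each \<open>C i\<close> has exactly \<open>h\<close> colors, all unique, so one cycle
  neighbor must bring a color outside \<open>C i\<close>: the successor, or for position
  \<open>0\<close> the predecessor. Lists of size \<open>2 * h + 1\<close> shrink by
  \<open>h\<close>, at \<open>l - 1\<close> by \<open>2 * h\<close>, and at \<open>1\<close> not at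
  all.\<close>

lemma good_smallest_degree:
  assumes D2: "D = h + 2"
  shows "\<exists>g. \<forall>i<l. good i (g (cpred l i)) (g i) (g (csucc l i))"
proof -
  have cC: "card (C i) = h" if "i < l" for i
    using card_C[OF that] card_U[OF that] card_mono[OF fin_C U_C] that D2 by force
  have cL: "2 * h + 1 \<le> card (L i)" if "i < l" for i
    using card_L[OF that] cC[OF that] D2 by simp
  define M where "M i = (if i = 1 then L 1 else if i = l - 1 then L i - C (l - 2) - C 0
      else L i - C (cpred l i))" for i
  have "\<exists>g. \<forall>i<l. g i \<in> M i \<and> g i \<noteq> g (csucc l i)"
  proof (rule cycle_coloring_1_2_3[OF l])
    have "1 \<le> card (L (l - 1) - C (l - 2) - C 0)"
      using card_Diff_Diff_ge[of "C (l - 2)" "C 0" "L (l - 1)"] fin_C cC cL[of "l - 1"] l by simp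
    then show "1 \<le> card (M (l - 1))" using l by (simp add: M_def)
    show "3 \<le> card (M 1)" using cL[of 1] l h by (simp add: M_def)
    fix i assume i: "i < l - 1"
    then have il: "i < l" by simp
    then have p: "cpred l i < l" by (rule cpred_less)
    have "2 \<le> card (L i - C (cpred l i))"
      using card_Diff_Diff_ge[of "C (cpred l i)" "{}" "L i"] fin_C[OF p] cC[OF p] cL[OF il] h by simp
    moreover have "2 \<le> card (L i)" using cL[OF il] h by simp
    ultimately show "2 \<le> card (M i)" using i by (auto simp: M_def)
  qed
  then obtain g where g: "\<And>i. i < l \<Longrightarrow> g i \<in> M i" "\<And>i. i < l \<Longrightarrow> g i \<noteq> g (csucc l i)" by blast
  have "good i (g (cpred l i)) (g i) (g (csucc l i))" if i: "i < l" for i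
  proof -
    have "g i \<in> L i" using g(1)[OF i] by (auto simp: M_def split: if_splits)
    moreover have "g (cpred l i) \<notin> C i \<or> g (csucc l i) \<notin> C i"
    proof (cases "i = 0")
      case True
      then show ?thesis using g(1)[of "l - 1"] l by (auto simp: M_def cpred_def split: if_splits)
    next
      case False
      then have "csucc l i \<noteq> 1" by (simp add: csucc_def)
      moreover have "i = l - 2" if "csucc l i = l - 1"
        using that l i by (simp add: csucc_def split: if_splits)
      ultimately show ?thesis
        using g(1)[OF csucc_less[OF i]] cpred_csucc[OF i]
        by (cases "csucc l i = l - 1") (simp_all add: M_def)
    qed
    ultimately show ?thesis using g(2)[OF i] by (auto simp: good_def)
  qed
  then show ?thesis by blast
qed

text \<open>Here \<open>C i = U i\<close> has \<open>h + 1\<close> elements, since only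
  \<open>h\<close> outside colors would leave fewer than \<open>h\<close> unique ones. So one unique
  color can be spared, and a color shared by both neighbors destroys no more.\<close>

lemma good_of_cycle_solution:
  assumes D3: "D = h + 3" and sol: "cycle_solution l L U g"
  shows "\<forall>i<l. good i (g (cpred l i)) (g i) (g (csucc l i))"
proof (intro allI impI)
  fix i assume i: "i < l"
  have CU: "C i = U i \<and> card (U i) = h + 1"
    using U_less[OF i] U_eq[OF i] card_C[OF i] card_U[OF i] D3 by force
  show "good i (g (cpred l i)) (g i) (g (csucc l i))"
  proof (cases "g (cpred l i) \<in> U i \<and> g (csucc l i) \<in> U i")
    case True
    then have "g (cpred l i) = g (csucc l i)" using sol i by (simp add: cycle_solution_def)
    then have "h \<le> card (U i - {g (cpred l i), g (csucc l i)})"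
      using CU by (simp add: card_Diff_singleton_if)
    then show ?thesis using sol i by (simp add: good_def cycle_solution_def)
  next
    case False
    then show ?thesis using sol i CU by (auto simp: good_def cycle_solution_def)
  qed
qed

lemma U_second_degree:
  assumes "D = h + 3" "i < l"
  shows "card (U i) = h + 1" "2 * h + 1 \<le> card (L i)" "L i \<inter> U i = {}"
proof -
  have CU: "C i = U i \<and> card (U i) = h + 1"
    using U_less[OF assms(2)] U_eq[OF assms(2)] card_C[OF assms(2)] card_U[OF assms(2)] assms(1) by force
  then show "card (U i) = h + 1" "2 * h + 1 \<le> card (L i)" "L i \<inter> U i = {}"
    using card_L[OF assms(2)] L_C[OF assms(2)] assms by auto
qed

lemma good_crossing:
  assumes D3: "D = h + 3" and h1: "h = 1" and cross: "U 0 \<subseteq> L 1" "U 0 \<subseteq> L (l - 1)"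
  shows "\<exists>g. \<forall>i<l. good i (g (cpred l i)) (g i) (g (csucc l i))"
proof -
  have "\<exists>g. cycle_solution l L U g"
    using cycle_solution_crossing[of l L U] U_second_degree D3 h1 cross l by force
  then show ?thesis using good_of_cycle_solution[OF D3] by blast
qed

lemma T_exists: "\<exists>T. \<forall>i<l. T i \<subseteq> U i \<and> card (T i) = h"
proof -
  have "\<exists>T\<subseteq>U i. card T = h" if "i < l" for i
    using card_U[OF that] fin_U[OF that] obtain_subset_with_card_n by metis
  then show ?thesis by metis
qed

lemma poor_card:
  assumes D4: "h + 4 \<le> D" and i: "i < l" and poor: "card (U i) \<le> h + 1"
  shows "card (C i) \<le> D - 3"
  using card_C[OF i] U_eq[OF i] poor D4 by (cases "card (C i) = D - 2") auto

text \<open>A position with \<open>h + 2\<close> unique colors can lose two and asks nothing of its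
  neighbors; every other position protects \<open>h\<close> colors from both. Each position in
  \<open>F\<close> thus saves its neighbors \<open>h\<close> exclusions, and a position outside
  \<open>F\<close> has a list longer by one, because its outside neighbors repeat a color.\<close>

lemma good_rich:
  assumes D4: "h + 4 \<le> D" and rich: "h + 2 \<le> card (U 0)"
  shows "\<exists>g. \<forall>i<l. good i (g (cpred l i)) (g i) (g (csucc l i))"
proof -
  define F where "F = {i. i < l \<and> h + 2 \<le> card (U i)}"
  obtain T0 where T0: "\<And>i. i < l \<Longrightarrow> T0 i \<subseteq> U i \<and> card (T0 i) = h" using T_exists by blast
  define T where "T i = (if i \<in> F then {} else T0 i)" for i
  have T: "finite (T i)" "card (T i) \<le> (if i \<in> F then 0 else h)" "T i \<subseteq> U i" if "i < l" for i
    using T0[OF that] fin_U[OF that] finite_subset by (auto simp: T_def)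
  define M where "M i = L i - T (cpred l i) - T (csucc l i)" for i
  have M: "(if i \<in> F then 1 else 2) + card ({cpred l i, csucc l i} \<inter> F) \<le> card (M i)" if i: "i < l" for i
  proof -
    let ?p = "cpred l i" and ?s = "csucc l i"
    have ps: "?p < l" "?s < l" "?s \<noteq> ?p" using i cpred_less csucc_less csucc_neq_cpred l by auto
    have f: "card ({?p, ?s} \<inter> F) = (if ?p \<in> F then 1 else 0) + (if ?s \<in> F then 1 else 0)"
      using ps(3) by (simp add: Int_insert_left)
    have "card (L i) \<le> card (M i) + card (T ?p) + card (T ?s)"
      unfolding M_def using card_Diff_Diff_ge T(1) ps by blast
    moreover have "2 * h + (if i \<in> F then 1 else 2) \<le> card (L i)"
      using card_L[OF i] card_C[OF i] poor_card[OF D4 i] D4 i by (auto simp: F_def)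
    ultimately show ?thesis
      using f T(2)[OF ps(1)] T(2)[OF ps(2)] h by (auto split: if_splits)
  qed
  have "\<exists>g. \<forall>i<l. g i \<in> M i \<and> g i \<noteq> g (csucc l i)"
  proof (rule cycle_coloring_marked[OF l])
    show "0 \<in> F" using rich l by (simp add: F_def)
    fix i assume i: "i < l"
    show "1 + card ({cpred l i, csucc l i} \<inter> F) \<le> card (M i)" if "i \<in> F" using M[OF i] that by simp
    show "2 + card ({cpred l i, csucc l i} \<inter> F) \<le> card (M i)" if "i \<notin> F" using M[OF i] that by simp
  qed
  then obtain g where g: "\<And>i. i < l \<Longrightarrow> g i \<in> M i" "\<And>i. i < l \<Longrightarrow> g i \<noteq> g (csucc l i)" by blast
  have "good i (g (cpred l i)) (g i) (g (csucc l i))" if i: "i < l" for i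
  proof -
    let ?p = "cpred l i" and ?s = "csucc l i"
    have "g ?p \<notin> T i" "g ?s \<notin> T i"
      using g(1)[OF cpred_less[OF i]] g(1)[OF csucc_less[OF i]] cpred_csucc[OF i] csucc_cpred[OF i]
      by (auto simp: M_def)
    have "h \<le> card (U i - {g ?p, g ?s})"
    proof (cases "i \<in> F")
      case True
      have "card (U i) \<le> card (U i - {g ?p, g ?s}) + card {g ?p, g ?s}"
        using diff_card_le_card_Diff[of "{g ?p, g ?s}" "U i"] by simp
      moreover have "card {g ?p, g ?s} \<le> 2" by (simp add: card_insert_if)
      ultimately show ?thesis using True by (simp add: F_def)
    next
      case False
      have "T i \<subseteq> U i - {g ?p, g ?s}"
        using T(3)[OF i] \<open>g ?p \<notin> T i\<close> \<open>g ?s \<notin> T i\<close> by auto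
      then have "card (T i) \<le> card (U i - {g ?p, g ?s})" using fin_U[OF i] by (intro card_mono) auto
      then show ?thesis using False T0[OF i] by (simp add: T_def)
    qed
    then show ?thesis using g[OF i] by (auto simp: good_def M_def)
  qed
  then show ?thesis by blast
qed

text \<open>
  If all vertices of the cycle are poor, the lists have size at least two. Either some list is
  longer, or the colors around vertex 0 form one pair and otherwise single colors; then vertex 0
  can be satisfied by its predecessor alone, which relieves its successor.
\<close>

lemma good_poor:
  assumes D4: "h + 4 \<le> D" and poor: "\<And>i. i < l \<Longrightarrow> card (U i) \<le> h + 1"
    and first: "card (C 1) + 4 \<le> D \<or> (\<forall>i<l. card (C i) + 3 = D)"
  shows "\<exists>g. \<forall>i<l. good i (g (cpred l i)) (g i) (g (csucc l i))"
proof -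
  obtain T where T: "\<And>i. i < l \<Longrightarrow> T i \<subseteq> U i \<and> card (T i) = h" using T_exists by blast
  have fin_T: "finite (T i)" if "i < l" for i using T[OF that] fin_U[OF that] finite_subset by blast
  have avoid: "h \<le> card (U i - {x, y})" if "i < l" "x \<notin> T i" "y \<notin> T i" for i x y
    using T[OF that(1)] that card_mono[of "U i - {x, y}" "T i"] fin_U[OF that(1)] by auto
  have l0: "0 < l" "1 < l" "l - 1 < l" "l - 2 < l" using l by auto
  have cL: "2 * h + 2 \<le> card (L i)" if "i < l" for i
    using card_L[OF that] poor_card[OF D4 that poor[OF that]] D4 by linarith
  \<comment> \<open>For the sake of position \<open>0\<close>, position \<open>1\<close> will avoid
    \<open>B\<close> and position \<open>l - 1\<close> will avoid \<open>W\<close>.\<close>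
  have "\<exists>B W. finite B \<and> finite W \<and> card W \<le> h + 1 \<and> 3 + card B + h \<le> card (L 1) \<and>
      (\<forall>x y. x \<notin> W \<longrightarrow> y \<notin> B \<longrightarrow> h \<le> card (U 0 - {x, y}) \<or> x \<notin> C 0)"
    using first
  proof
    assume "card (C 1) + 4 \<le> D"
    then have "3 + card (T 0) + h \<le> card (L 1)" using card_L[OF l0(2)] T[OF l0(1)] by linarith
    then show ?thesis
      using T[OF l0(1)] fin_T[OF l0(1)] avoid[OF l0(1)] by (intro exI[of _ "T 0"]) auto
  next
    assume tight: "\<forall>i<l. card (C i) + 3 = D"
    then have C0: "card (C 0) + 3 = D" using l0 by blast
    \<comment> \<open>\<open>U 0\<close> has \<open>h\<close> or \<open>h + 1\<close> elements here.
      If \<open>h\<close>, then \<open>D = h + 4\<close>, and avoiding the \<open>h + 1\<close>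
      colors of \<open>C 0\<close> gives the predecessor a fresh color. If \<open>h + 1\<close>,
      avoiding \<open>U 0\<close> leaves only position \<open>1\<close> to destroy a color.\<close>
    define W where "W = (if card (U 0) = h then C 0 else U 0)"
    have "D \<le> card (U 0) + 4" using C_U[OF l0(1)] C0 D4 by linarith
    moreover have "card (U 0) < card (C 0)" using U_less[OF l0(1)] C0 D4 by linarith
    ultimately have "card W \<le> h + 1"
      using C0 poor[OF l0(1)] by (auto simp: W_def)
    moreover have "finite W" using fin_C[OF l0(1)] fin_U[OF l0(1)] by (simp add: W_def)
    moreover have "3 + card ({} :: nat set) + h \<le> card (L 1)" using cL[OF l0(2)] h by simp
    moreover have "h \<le> card (U 0 - {x, y}) \<or> x \<notin> C 0" if "x \<notin> W" for x y
    proof (cases "card (U 0) = h")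
      case True
      then show ?thesis using that by (simp add: W_def)
    next
      case False
      then have "U 0 - {x, y} = U 0 - {y}" using that by (auto simp: W_def)
      moreover have "h \<le> card (U 0) - 1" using False card_U[OF l0(1)] by simp
      moreover have "card (U 0) - 1 \<le> card (U 0 - {y})" by (simp add: card_Diff_singleton_if)
      ultimately show ?thesis by (metis le_trans)
    qed
    ultimately show ?thesis
      by (intro exI[of _ "{}"] exI[of _ W] conjI allI impI) (assumption | simp)+
  qed
  then obtain B W where BW: "finite B" "finite W" "card W \<le> h + 1" "3 + card B + h \<le> card (L 1)"
    "\<And>x y. x \<notin> W \<Longrightarrow> y \<notin> B \<Longrightarrow> h \<le> card (U 0 - {x, y}) \<or> x \<notin> C 0" by blast
  define M where "M i = (if i = 1 then L 1 - B - T (csucc l 1)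
      else if i = l - 1 then L i - T (l - 2) - W else L i - T (cpred l i) - T (csucc l i))" for i
  have "\<exists>g. \<forall>i<l. g i \<in> M i \<and> g i \<noteq> g (csucc l i)"
  proof (rule cycle_coloring_1_2_3[OF l])
    have "1 \<le> card (L (l - 1) - T (l - 2) - W)"
      using card_Diff_Diff_ge[of "T (l - 2)" W "L (l - 1)"] fin_T[OF l0(4)] T[OF l0(4)] BW cL[OF l0(3)]
      by simp
    then show "1 \<le> card (M (l - 1))" using l by (simp add: M_def)
    have s1: "csucc l 1 < l" using csucc_less l0 by blast
    show one: "3 \<le> card (M 1)"
      using card_Diff_Diff_ge[of B "T (csucc l 1)" "L 1"] fin_T[OF s1] T[OF s1] BW by (simp add: M_def)
    fix i assume i: "i < l - 1"
    then have il: "i < l" by simp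
    show "2 \<le> card (M i)"
    proof (cases "i = 1")
      case True
      then show ?thesis using one by simp
    next
      case False
      have ps: "cpred l i < l" "csucc l i < l" using il cpred_less csucc_less by auto
      have "card (L i) \<le> card (L i - T (cpred l i) - T (csucc l i)) + h + h"
        using card_Diff_Diff_ge[of "T (cpred l i)" "T (csucc l i)" "L i"] fin_T ps T by simp
      then show ?thesis using False i cL[OF il] by (simp add: M_def)
    qed
  qed
  then obtain g where g: "\<And>i. i < l \<Longrightarrow> g i \<in> M i" "\<And>i. i < l \<Longrightarrow> g i \<noteq> g (csucc l i)" by blast
  have "good i (g (cpred l i)) (g i) (g (csucc l i))" if i: "i < l" for i
  proof -
    let ?p = "cpred l i" and ?s = "csucc l i"
    have "h \<le> card (U i - {g ?p, g ?s}) \<or> g ?p \<notin> C i"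
    proof (cases "i = 0")
      case True
      have ps: "?p = l - 1" "?s = 1" using True l by (auto simp: cpred_def csucc_def)
      have "g (l - 1) \<notin> W" "g 1 \<notin> B" using g(1)[OF l0(3)] g(1)[OF l0(2)] l
        by (auto simp: M_def split: if_splits)
      then show ?thesis using BW(5) True ps by simp
    next
      case False
      have "?s \<noteq> 1" using False by (simp add: csucc_def)
      moreover have "i = l - 2" if "?s = l - 1"
        using that l i by (simp add: csucc_def split: if_splits)
      ultimately have s: "g ?s \<notin> T i"
        using g(1)[OF csucc_less[OF i]] cpred_csucc[OF i]
        by (cases "?s = l - 1") (simp_all add: M_def)
      have "?p \<noteq> l - 1" using False i by (auto simp: cpred_def)
      then have "g ?p \<notin> T i"
        using g(1)[OF cpred_less[OF i]] csucc_cpred[OF i]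
        by (cases "?p = 1") (simp_all add: M_def)
      then show ?thesis using avoid[OF i _ s] by blast
    qed
    moreover have "g i \<in> L i" using g(1)[OF i] by (auto simp: M_def split: if_splits)
    ultimately show ?thesis using g(2)[OF i] by (auto simp: good_def)
  qed
  then show ?thesis by blast
qed

end

lemma (in cycle_lists) good_exists:
  "\<exists>g. \<forall>i<l. good i (g (cpred l i)) (g i) (g (csucc l i))"
proof -
  have shift: ?thesis if m: "m < l" and
    ex: "\<exists>g. \<forall>i<l. cycle_lists.good h (\<lambda>i. L ((i + m) mod l)) (\<lambda>i. C ((i + m) mod l))
      (\<lambda>i. U ((i + m) mod l)) i (g (cpred l i)) (g i) (g (csucc l i))" for m
  proof -
    have eq: "cycle_lists.good h (\<lambda>i. L ((i + m) mod l)) (\<lambda>i. C ((i + m) mod l))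
      (\<lambda>i. U ((i + m) mod l)) i = good ((i + m) mod l)" for i
      unfolding good_def cycle_lists.good_def[OF shifted] by (rule refl)
    show ?thesis using cycle_shift[OF m, of good] ex unfolding eq by blast
  qed
  consider "D = h + 2" | "D = h + 3" "2 \<le> h" | "D = h + 3" "h = 1" | "h + 4 \<le> D"
    using D h by linarith
  then show ?thesis
  proof cases
    case 1
    then show ?thesis by (rule good_smallest_degree)
  next
    case 2
    have "\<exists>g. cycle_solution l L U g"
      using cycle_solution_large[OF l 2(2), of L U] U_second_degree[OF 2(1)] fin_U by auto
    then show ?thesis using good_of_cycle_solution[OF 2(1)] by blast
  next
    case 3
    have u: "card (U i) = 2" "3 \<le> card (L i)" if "i < l" for i
      using U_second_degree[OF 3(1) that] 3(2) by auto
    show ?thesis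
    proof (cases "\<exists>i<l. U i \<subseteq> L (cpred l i) \<and> U i \<subseteq> L (csucc l i)")
      case True
      then obtain m where m: "m < l" "U m \<subseteq> L (cpred l m)" "U m \<subseteq> L (csucc l m)" by blast
      have 1: "(1 + m) mod l = csucc l m" using m l by (auto simp: csucc_def)
      have 2: "(l - 1 + m) mod l = cpred l m"
      proof (cases m)
        case (Suc n)
        then have "l - 1 + m = n + l" using l by simp
        then show ?thesis using Suc m by (simp add: cpred_def)
      qed (use l in \<open>auto simp: cpred_def\<close>)
      show ?thesis
        by (rule shift[OF m(1)], rule cycle_lists.good_crossing[OF shifted 3])
          (use m 1 2 in simp_all)
    next
      case False
      then have "\<exists>g. cycle_solution l L U g" using cycle_solution_simple[OF l, of L U] u by blast
      then show ?thesis using good_of_cycle_solution[OF 3(1)] by blast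
    qed
  next
    case 4
    show ?thesis
    proof (cases "\<exists>m<l. h + 2 \<le> card (U m)")
      case True
      then obtain m where m: "m < l" "h + 2 \<le> card (U m)" by blast
      show ?thesis
        by (rule shift[OF m(1)], rule cycle_lists.good_rich[OF shifted 4]) (use m in simp)
    next
      case False
      then have poor: "card (U i) \<le> h + 1" if "i < l" for i using that by fastforce
      show ?thesis
      proof (cases "\<exists>j<l. card (C j) + 4 \<le> D")
        case True
        then obtain j where j: "j < l" "card (C j) + 4 \<le> D" by blast
        \<comment> \<open>Rotating by the predecessor of \<open>j\<close> brings \<open>j\<close> to
          position \<open>1\<close>, where \<open>good_poor\<close> expects the longer list.\<close>
        have p: "cpred l j < l" using cpred_less[OF j(1)] .
        have e: "(1 + cpred l j) mod l = j" using j l by (auto simp: cpred_def)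
        have ml: "(i + cpred l j) mod l < l" for i using l by simp
        show ?thesis
          by (rule shift[OF p], rule cycle_lists.good_poor[OF shifted 4]) (use poor ml e j in auto)
      next
        case no: False
        have "card (C i) + 3 = D" if "i < l" for i
        proof -
          have "\<not> card (C i) + 4 \<le> D" using no that by blast
          then show ?thesis using poor_card[OF 4 that poor[OF that]] 4 by linarith
        qed
        then show ?thesis using good_poor[OF 4 poor] by blast
      qed
    qed
  qed
qed

section \<open>Partial colorings\<close>

lemma inj_on_shift:
  fixes q :: "nat \<Rightarrow> 'a"
  assumes "inj_on q {..<l}" "a + m \<le> l"
  shows "inj_on (\<lambda>i. q (a + i)) {..<m}"
proof (rule inj_onI)
  fix x y assume "x \<in> {..<m}" "y \<in> {..<m}" "q (a + x) = q (a + y)"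
  then show "x = y" using inj_onD[OF assms(1), of "a + x" "a + y"] assms(2) by simp
qed

text \<open>This models one component. \<open>D\<close> is the maximum degree of the whole graph,
  hence only a bound here, and \<open>N\<close> is empty outside \<open>V\<close>.\<close>

locale nbr_graph =
  fixes V :: "'a set" and N :: "'a \<Rightarrow> 'a set" and h D :: nat and X :: "nat set"
  assumes finite_V: "finite V"
    and N_sub: "N v \<subseteq> V"
    and irrefl: "v \<notin> N v"
    and sym: "u \<in> N v \<Longrightarrow> v \<in> N u"
    and deg_le: "card (N v) \<le> D"
    and h_pos: "1 \<le> h"
    and D_ge: "h + 2 \<le> D"
    and finite_X: "finite X"
    and card_X: "card X = (h + 1) * D - 1"
begin

lemma finite_N [simp]: "finite (N v)"
  using N_sub finite_V finite_subset by blast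

lemma sym_iff: "u \<in> N v \<longleftrightarrow> v \<in> N u"
  using sym by blast

lemma card_X_eq: "card X = h * D + D - 1"
  using card_X by simp

text \<open>
  The second alternative concerns vertices of degree \<open>h + 2\<close> with at most one uncolored neighbor,
  for which one coincidence among the neighbors is tolerated: a fresh color on the last neighbor still
  makes \<open>h\<close> colors unique.
\<close>

definition okay :: "('a \<Rightarrow> nat) \<Rightarrow> 'a set \<Rightarrow> 'a \<Rightarrow> bool" where
  "okay c S w \<longleftrightarrow> min (card (N w \<inter> S)) h \<le> card (uniques c (N w \<inter> S)) \<or>
     card (N w) = h + 2 \<and> h + 1 \<le> card (N w \<inter> S) \<and> card (N w \<inter> S) \<le> card (c ` (N w \<inter> S)) + 1"

definition valid :: "('a \<Rightarrow> nat) \<Rightarrow> 'a set \<Rightarrow> bool" where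
  "valid c S \<longleftrightarrow> S \<subseteq> V \<and> c ` S \<subseteq> X \<and> (\<forall>u\<in>S. \<forall>v\<in>N u \<inter> S. c u \<noteq> c v) \<and> (\<forall>w. okay c S w)"

text \<open>
  The colors that an uncolored neighbor of \<open>w\<close> has to avoid in order to keep \<open>w\<close> okay, the
  color of \<open>w\<close> itself excepted.
\<close>

definition cost :: "('a \<Rightarrow> nat) \<Rightarrow> 'a set \<Rightarrow> 'a \<Rightarrow> nat set" where
  "cost c S w =
     (if h < card (uniques c (N w \<inter> S)) \<or> card (N w) = h + 2 \<and> card (N w \<inter> S) = h then {}
      else if min (card (N w \<inter> S)) h \<le> card (uniques c (N w \<inter> S)) then uniques c (N w \<inter> S)
      else c ` (N w \<inter> S))"

definition blocked :: "('a \<Rightarrow> nat) \<Rightarrow> 'a set \<Rightarrow> 'a \<Rightarrow> nat set" where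
  "blocked c S u = c ` (N u \<inter> S) \<union> (\<Union>w\<in>N u. cost c S w)"

lemma valid_cong:
  assumes "\<And>u. u \<in> S \<Longrightarrow> c u = c' u"
  shows "valid c S = valid c' S"
proof -
  have 1: "uniques c (N w \<inter> S) = uniques c' (N w \<inter> S)" for w
    using assms by (intro uniques_cong) auto
  have 2: "c ` (N w \<inter> S) = c' ` (N w \<inter> S)" for w
    using assms by (intro image_cong) auto
  have 3: "c ` S = c' ` S"
    using assms by (intro image_cong) auto
  have 4: "(\<forall>u\<in>S. \<forall>v\<in>N u \<inter> S. c u \<noteq> c v) = (\<forall>u\<in>S. \<forall>v\<in>N u \<inter> S. c' u \<noteq> c' v)"
    using assms by simp
  show ?thesis
    unfolding valid_def okay_def 1 2 3 4 ..
qed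

lemma finite_cost [simp]: "finite (cost c S w)"
  by (simp add: cost_def)

lemma finite_blocked [simp]: "finite (blocked c S w)"
  by (simp add: blocked_def)

lemma card_Int_less:
  assumes "u \<in> N w" "u \<notin> S"
  shows "card (N w \<inter> S) < card (N w)"
  using assms by (intro psubset_card_mono) auto

text \<open>Only the exclusion of all colors around \<open>w\<close> needs an argument: then
  \<open>w\<close> has degree \<open>h + 2\<close>, and as \<open>u\<close> is uncolored, its
  colored neighbors number \<open>h + 1\<close> and repeat a color.\<close>

lemma card_cost_le:
  assumes "okay c S w" "u \<in> N w" "u \<notin> S"
  shows "card (cost c S w) \<le> h"
proof -
  let ?A = "N w \<inter> S"
  have "card (c ` ?A) \<le> h" if "\<not> min (card ?A) h \<le> card (uniques c ?A)"
  proof -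
    from that have "\<not> inj_on c ?A"
      by (auto simp: uniques_inj_on card_image)
    then have "card (c ` ?A) < card ?A"
      using card_uniques_less(2)[of ?A c] by simp
    moreover have "card ?A < h + 2"
      using that assms card_Int_less[OF assms(2,3)] by (simp add: okay_def)
    ultimately show ?thesis by simp
  qed
  then show ?thesis by (simp add: cost_def)
qed

text \<open>With more than \<open>h\<close> unique colors, one may be lost. With degree
  \<open>h + 2\<close> and \<open>h\<close> colored neighbors, these differ, and a repetition
  becomes the tolerated coincidence. Otherwise the new color is fresh or repeats an already repeated
  one; after a tolerated coincidence it must be fresh.\<close>

lemma okay_extend:
  assumes ok: "okay c S w" and u: "u \<in> N w" "u \<notin> S" and a: "a \<notin> cost c S w"
  shows "okay (c(u := a)) (insert u S) w"
proof -
  let ?A = "N w \<inter> S" and ?c = "c(u := a)"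
  have B: "N w \<inter> insert u S = insert u ?A" using u by auto
  have uA: "u \<notin> ?A" using u by auto
  have card_B: "card (insert u ?A) = card ?A + 1" using uA by simp
  have im: "?c ` ?A = c ` ?A" using u by (intro image_cong) auto
  have im_ins: "?c ` insert u ?A = insert a (c ` ?A)"
    by (simp only: image_insert fun_upd_same im)
  have uq: "uniques ?c ?A = uniques c ?A" using u by (intro uniques_cong) auto
  have old: "uniques ?c (insert u ?A) = uniques c ?A - {a}" if "a \<in> c ` ?A"
    using uniques_insert_old[OF uA, of ?c] that by (simp only: im uq fun_upd_same)
  have new: "uniques ?c (insert u ?A) = insert a (uniques c ?A)" if "a \<notin> c ` ?A"
    using uniques_insert_new[OF uA, of ?c] that by (simp only: im uq fun_upd_same not_False_eq_True)
  have new_card: "card (uniques ?c (insert u ?A)) = card (uniques c ?A) + 1" if "a \<notin> c ` ?A"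
  proof -
    have "a \<notin> uniques c ?A" using that uniques_subset[of c ?A] by blast
    then show ?thesis using new[OF that] by simp
  qed
  have less: "card ?A < card (N w)" using card_Int_less u by blast
  consider (rich) "h < card (uniques c ?A)"
    | (special) "card (uniques c ?A) \<le> h" "card (N w) = h + 2" "card ?A = h"
    | (plain) "card (uniques c ?A) \<le> h" "min (card ?A) h \<le> card (uniques c ?A)"
       "\<not> (card (N w) = h + 2 \<and> card ?A = h)"
    | (pair) "card (uniques c ?A) < min (card ?A) h" "\<not> (card (N w) = h + 2 \<and> card ?A = h)"
    by linarith
  then show ?thesis
  proof cases
    case rich
    have "h \<le> card (uniques ?c (insert u ?A))"
    proof (cases "a \<in> c ` ?A")
      case True
      have "h \<le> card (uniques c ?A - {a})" using rich by (auto simp: card_Diff_singleton_if)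
      then show ?thesis unfolding old[OF True] .
    next
      case False
      show ?thesis unfolding new_card[OF False] using rich by simp
    qed
    then show ?thesis unfolding okay_def B by linarith
  next
    case special
    then have "h \<le> card (uniques c ?A)" using ok by (simp add: okay_def)
    moreover have "card (uniques c ?A) < h" if "\<not> inj_on c ?A"
      using special card_uniques_less[of ?A c] that by simp
    ultimately have "inj_on c ?A" by (meson leD)
    then have "card (c ` ?A) = h" using special by (simp add: card_image)
    then have "h \<le> card (insert a (c ` ?A))"
      using card_mono[of "insert a (c ` ?A)" "c ` ?A"] by auto
    then show ?thesis unfolding okay_def B im_ins card_B using special by simp
  next
    case plain
    then have cost: "a \<notin> uniques c ?A" using a by (auto simp: cost_def split: if_splits)
    show ?thesis
    proof (cases "a \<in> c ` ?A")
      case True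
      then have "\<not> inj_on c ?A" using cost uniques_inj_on by blast
      then have "card (uniques c ?A) < card ?A" using card_uniques_less[of ?A c] by simp
      then have "h \<le> card (uniques c ?A)" using plain by simp
      then have "min (card (insert u ?A)) h \<le> card (uniques c ?A - {a})"
        using cost by (simp add: min.coboundedI2)
      then show ?thesis unfolding okay_def B old[OF True] by (rule disjI1)
    next
      case False
      have "min (card ?A + 1) h \<le> card (uniques c ?A) + 1" using plain by linarith
      then show ?thesis unfolding okay_def B new_card[OF False] card_B by (rule disjI1)
    qed
  next
    case pair
    then have "a \<notin> c ` ?A" using a by (auto simp: cost_def split: if_splits)
    then have "card (insert a (c ` ?A)) = card (c ` ?A) + 1" by simp
    moreover have "card (N w) = h + 2 \<and> h + 1 \<le> card ?A \<and> card ?A \<le> card (c ` ?A) + 1"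
      using pair ok unfolding okay_def by linarith
    ultimately show ?thesis unfolding okay_def B card_B im_ins by simp
  qed
qed

lemma valid_extend:
  assumes val: "valid c S" and u: "u \<in> V" "u \<notin> S" and a: "a \<in> X" "a \<notin> blocked c S u"
  shows "valid (c(u := a)) (insert u S)"
proof -
  let ?c = "c(u := a)"
  have "insert u S \<subseteq> V" "?c ` insert u S \<subseteq> X"
    using val u a by (auto simp: valid_def)
  moreover have "?c x \<noteq> ?c y" if "x \<in> insert u S" "y \<in> N x \<inter> insert u S" for x y
    using that val u a irrefl[of u] sym[of y x] unfolding valid_def blocked_def
    by (auto simp: image_iff)
  moreover have "okay ?c (insert u S) w" for w
  proof (cases "u \<in> N w")
    case True
    then have "a \<notin> cost c S w" using a sym by (auto simp: blocked_def)
    then show ?thesis using okay_extend True u val by (simp add: valid_def)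
  next
    case False
    then have B: "N w \<inter> insert u S = N w \<inter> S" by auto
    have 1: "uniques ?c (N w \<inter> S) = uniques c (N w \<inter> S)"
      using u by (intro uniques_cong) auto
    have 2: "?c ` (N w \<inter> S) = c ` (N w \<inter> S)"
      using u by (intro image_cong) auto
    show ?thesis using val unfolding valid_def okay_def B 1 2 by blast
  qed
  ultimately show ?thesis unfolding valid_def by blast
qed

lemma card_blocked_le:
  assumes val: "valid c S" and u: "u \<notin> S"
  shows "card (blocked c S u) \<le> card (c ` (N u \<inter> S)) + h * card (N u)"
proof -
  have "card (\<Union>w\<in>N u. cost c S w) \<le> (\<Sum>w\<in>N u. card (cost c S w))"
    by (intro card_UN_le) simp
  also have "\<dots> \<le> (\<Sum>w\<in>N u. h)"
    using val u by (intro sum_mono card_cost_le[of _ _ _ u]) (auto simp: valid_def sym_iff)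
  also have "\<dots> = h * card (N u)" by simp
  finally show ?thesis
    unfolding blocked_def using card_Un_le[of "c ` (N u \<inter> S)" "\<Union>w\<in>N u. cost c S w"] by linarith
qed

text \<open>At most \<open>(h + 1) * (D - 1)\<close> colors are blocked in the first case and
  \<open>h * D\<close> in the second. The first count allows all neighbors to be colored, so it can
  complete a coloring.\<close>

lemma valid_extend_low_degree:
  assumes val: "valid c S" and u: "u \<in> V" "u \<notin> S" and deg: "card (N u) < D \<or> N u \<inter> S = {}"
  shows "\<exists>a. valid (c(u := a)) (insert u S)"
proof -
  have im: "card (c ` (N u \<inter> S)) \<le> card (N u \<inter> S)" by (simp add: card_image_le)
  have "card (blocked c S u) < card X"
    using deg
  proof
    assume "card (N u) < D"
    then have le: "card (N u) \<le> D - 1" by simp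
    have "card (blocked c S u) \<le> card (N u) + h * card (N u)"
      using card_blocked_le[OF val u(2)] im card_mono[of "N u" "N u \<inter> S"] by simp
    also have "\<dots> \<le> (D - 1) + h * (D - 1)"
      using le by (intro add_mono mult_left_mono) auto
    also have "\<dots> < card X"
      using D_ge h_pos unfolding card_X_eq by (cases D) (auto simp: algebra_simps)
    finally show ?thesis .
  next
    assume "N u \<inter> S = {}"
    then have "card (blocked c S u) \<le> h * card (N u)"
      using card_blocked_le[OF val u(2)] by simp
    also have "\<dots> \<le> h * D" using deg_le by simp
    also have "\<dots> < card X" using D_ge by (simp add: card_X_eq)
    finally show ?thesis .
  qed
  then have "\<not> X \<subseteq> blocked c S u"
    using card_mono[of "blocked c S u" X] by auto
  then show ?thesis using valid_extend[OF val u] by blast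
qed

subsection \<open>Coloring everything but a connected remainder\<close>

lemma not_inj_if_cost_nonempty:
  assumes "okay c S w" "cost c S w \<noteq> {}" "card (N w \<inter> S) \<ge> h + 1"
  shows "\<not> inj_on c (N w \<inter> S)"
  using assms by (auto simp: cost_def uniques_inj_on card_image split: if_splits)

text \<open>Counted with multiplicity, at most \<open>h * D + (D - 1) = card X\<close> colors are
  excluded, since \<open>p\<close> is uncolored. Blocking all of \<open>X\<close> forces equality:
  \<open>D - 1\<close> distinct colors around \<open>u\<close>, every cost of size \<open>h\<close>,
  no overlap. So \<open>\<alpha>\<close> is excluded by the color of \<open>x\<close> alone, and
  recoloring \<open>x\<close> frees it unless another neighbor of \<open>u\<close> starts to exclude
  it.\<close>

lemma valid_recolor_extend:
  assumes val: "valid c S" and u: "u \<in> V" "u \<notin> S" and p: "p \<in> N u" "p \<notin> S"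
    and x: "x \<in> N u" "x \<in> S" and val_x: "valid c (S - {x})" and stuck: "X \<subseteq> blocked c S u"
  shows "\<exists>c'. valid c' (insert u S) \<and> valid c' S"
proof -
  define \<alpha> where "\<alpha> = c x"
  define S0 where "S0 = S - {x}"
  have xS0: "x \<notin> S0" "S = insert x S0" "x \<in> V" using x val by (auto simp: S0_def valid_def)
  have k_le: "card X \<le> card (blocked c S u)" using stuck by (simp add: card_mono)
  have stuck_less: False if "card (blocked c S u) < card X" using that k_le by simp
  have Nu_less: "card (N u \<inter> S) < card (N u)" using card_Int_less p by blast
  have im: "card (c ` (N u \<inter> S)) \<le> card (N u \<inter> S)" by (simp add: card_image_le)
  have deg_u: "card (N u) = D"
  proof (rule ccontr)
    assume "card (N u) \<noteq> D"
    then have le: "card (N u) \<le> D - 1" using deg_le[of u] by simp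
    have "card (blocked c S u) \<le> card (N u) + h * card (N u)"
      using card_blocked_le[OF val u(2)] im Nu_less by simp
    also have "\<dots> \<le> (D - 1) + h * (D - 1)"
      using le by (intro add_mono mult_left_mono) auto
    also have "\<dots> < card X"
      using D_ge h_pos unfolding card_X_eq by (cases D) (auto simp: algebra_simps)
    finally show False using stuck_less by blast
  qed
  have im_ge: "D - 1 \<le> card (c ` (N u \<inter> S))"
    using card_blocked_le[OF val u(2)] k_le deg_u D_ge by (simp add: card_X_eq)
  then have card_NuS: "card (N u \<inter> S) = D - 1" using im Nu_less deg_u by simp
  then have inj_u: "inj_on c (N u \<inter> S)"
    using im im_ge by (intro eq_card_imp_inj_on) auto
  have cost_w: "card (cost c S w) = h" if w: "w \<in> N u" for w
  proof (rule ccontr)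
    assume "card (cost c S w) \<noteq> h"
    moreover have le: "card (cost c S v) \<le> h" if "v \<in> N u" for v
      using val that u sym by (intro card_cost_le[of _ _ _ u]) (auto simp: valid_def)
    ultimately have "(\<Sum>w\<in>N u. card (cost c S w)) < (\<Sum>w\<in>N u. h)"
      using w by (intro sum_strict_mono_ex1) (auto intro!: bexI[of _ w] simp: le_neq_implies_less)
    moreover have "card (\<Union>w\<in>N u. cost c S w) \<le> (\<Sum>w\<in>N u. card (cost c S w))"
      by (intro card_UN_le) simp
    ultimately have "card (\<Union>w\<in>N u. cost c S w) < h * D"
      using deg_u by (simp add: mult.commute)
    then have "card (blocked c S u) < card X"
      unfolding blocked_def card_X_eq
      using card_Un_le[of "c ` (N u \<inter> S)" "\<Union>w\<in>N u. cost c S w"] im card_NuS D_ge by linarith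
    then show False using stuck_less by blast
  qed
  have \<alpha>_cost: "\<alpha> \<notin> cost c S w" if w: "w \<in> N u" for w
  proof
    assume "\<alpha> \<in> cost c S w"
    then have "blocked c S u \<subseteq> c ` (N u \<inter> S - {x}) \<union> (\<Union>w\<in>N u. cost c S w)"
      using w by (auto simp: blocked_def \<alpha>_def)
    then have "card (blocked c S u) \<le> card (c ` (N u \<inter> S - {x}) \<union> (\<Union>w\<in>N u. cost c S w))"
      by (intro card_mono) auto
    also have "\<dots> \<le> card (c ` (N u \<inter> S - {x})) + (\<Sum>w\<in>N u. card (cost c S w))"
      using card_Un_le[of "c ` (N u \<inter> S - {x})" "\<Union>w\<in>N u. cost c S w"]
        card_UN_le[of "N u" "cost c S"] by simp
    also have "card (c ` (N u \<inter> S - {x})) \<le> D - 2"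
      using card_image_le[of "N u \<inter> S - {x}" c] card_NuS x by simp
    also have "(\<Sum>w\<in>N u. card (cost c S w)) = h * D" using cost_w deg_u by simp
    also have "D - 2 + h * D < card X" using D_ge by (simp add: card_X_eq)
    finally show False using stuck_less by simp
  qed
  have cost_plain: "cost c S w = uniques c (N w \<inter> S) \<and> card (uniques c (N w \<inter> S)) = h"
    if w: "w \<in> N u" and xw: "x \<in> N w" for w
  proof -
    have "\<alpha> \<in> c ` (N w \<inter> S)" using xw x by (auto simp: \<alpha>_def)
    then show ?thesis using \<alpha>_cost[OF w] cost_w[OF w] h_pos by (auto simp: cost_def split: if_splits)
  qed
  \<comment> \<open>For a common neighbor \<open>w\<close> of \<open>u\<close> and \<open>x\<close> we also keep the new color of \<open>x\<close> away from
    the unique colors around \<open>w\<close>; otherwise \<open>\<alpha>\<close> could become a unique color that \<open>u\<close> must avoid.\<close>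
  define K where "K w = (if w = u then {} else if w \<in> N u then uniques c (N w \<inter> S) else cost c S0 w)" for w
  have val0: "valid c S0" using val_x by (simp add: S0_def)
  have x_notin: "x \<notin> N x" "u \<noteq> x" using irrefl x u by auto
  have u_Nx: "u \<in> N x" using x sym by blast
  \<comment> \<open>A common neighbor \<open>w\<close> does not exclude \<open>\<alpha>\<close>, so
    \<open>\<alpha>\<close> is not unique around it and occurs besides \<open>x\<close>. Removing
    \<open>x\<close> can therefore make at most \<open>\<alpha>\<close> unique.\<close>
  have triangle: "N w \<inter> S = insert x (N w \<inter> S0)" "x \<notin> N w \<inter> S0" "\<alpha> \<in> c ` (N w \<inter> S0)"
    "uniques c (N w \<inter> S) = uniques c (N w \<inter> S0) - {\<alpha>}" if w: "w \<in> N u" and xw: "x \<in> N w" for w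
  proof -
    show 1: "N w \<inter> S = insert x (N w \<inter> S0)" and 2: "x \<notin> N w \<inter> S0"
      using xw xS0 by auto
    show 3: "\<alpha> \<in> c ` (N w \<inter> S0)"
    proof (rule ccontr)
      assume "\<alpha> \<notin> c ` (N w \<inter> S0)"
      then have "\<alpha> \<in> uniques c (N w \<inter> S)"
        unfolding 1 using 2 by (subst uniques_insert_new) (auto simp: \<alpha>_def)
      then show False using \<alpha>_cost[OF w] cost_plain[OF w xw] by simp
    qed
    show "uniques c (N w \<inter> S) = uniques c (N w \<inter> S0) - {\<alpha>}"
      unfolding 1 using 2 3 by (simp add: uniques_insert_old \<alpha>_def)
  qed
  have cost_K: "cost c S0 w \<subseteq> K w" if xw: "w \<in> N x" for w
  proof -
    consider "w = u" | "w \<noteq> u" "w \<in> N u" | "w \<noteq> u" "w \<notin> N u" by blast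
    then show ?thesis
    proof cases
      case 1
      have inj0: "inj_on c (N u \<inter> S0)" using inj_u by (rule inj_on_subset) (auto simp: S0_def)
      have "N u \<inter> S0 = N u \<inter> S - {x}" by (auto simp: S0_def)
      then have m: "card (N u \<inter> S0) = D - 2" using card_NuS x by simp
      then have "card (uniques c (N u \<inter> S0)) = D - 2"
        using inj0 by (simp add: uniques_inj_on card_image)
      \<comment> \<open>The tolerated coincidence pays off: \<open>u\<close> sees
        \<open>D - 2\<close> distinct colors, more than \<open>h\<close> unless
        \<open>D = h + 2\<close>, and then the exemption for degree \<open>h + 2\<close> applies. So
        \<open>u\<close> costs \<open>x\<close> nothing.\<close>
      then have "cost c S0 u = {}" using m D_ge deg_u unfolding cost_def by auto
      then show ?thesis using 1 by simp
    next
      case 2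
      have xw': "x \<in> N w" using xw sym by blast
      note t = triangle[OF 2(2) xw']
      have ch: "card (uniques c (N w \<inter> S0) - {\<alpha>}) = h"
        using cost_plain[OF 2(2) xw'] t(4) by simp
      then have "h \<le> card (uniques c (N w \<inter> S0))"
        using card_mono[of "uniques c (N w \<inter> S0)" "uniques c (N w \<inter> S0) - {\<alpha>}"] by simp
      moreover have "\<alpha> \<notin> uniques c (N w \<inter> S0)" if "card (uniques c (N w \<inter> S0)) = h"
        using that ch h_pos by (auto simp: card_Diff_singleton)
      ultimately have "cost c S0 w \<subseteq> uniques c (N w \<inter> S)"
        using t(4) by (auto simp: cost_def)
      then show ?thesis using 2 by (simp add: K_def)
    next
      case 3
      then show ?thesis by (simp add: K_def)
    qed
  qed
  have card_K: "card (K w) \<le> h" if xw: "w \<in> N x" "w \<noteq> u" for w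
  proof (cases "w \<in> N u")
    case True
    then show ?thesis using cost_plain[OF True] xw sym by (simp add: K_def)
  next
    case False
    have "card (cost c S0 w) \<le> h"
      using val0 xw xS0 sym by (intro card_cost_le[of _ _ _ x]) (auto simp: valid_def)
    then show ?thesis using xw False by (simp add: K_def)
  qed
  have im_x: "card (c ` (N x \<inter> S0)) \<le> D - 2"
  proof -
    have eq: "N x \<inter> S0 = N x \<inter> S" using x_notin by (auto simp: S0_def)
    have less: "card (N x \<inter> S) < card (N x)" using card_Int_less[OF u_Nx u(2)] .
    show ?thesis
    proof (cases "card (N x \<inter> S) \<le> D - 2")
      case True
      then show ?thesis unfolding eq using card_image_le[of "N x \<inter> S" c] by simp
    next
      case False
      then have m: "card (N x \<inter> S) = D - 1" using less deg_le[of x] by simp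
      \<comment> \<open>Being a neighbor of the stuck \<open>u\<close>, \<open>x\<close> has a
        nonempty cost, so its neighbors repeat a color. The color saved is decisive for
        \<open>h = 1\<close>.\<close>
      have "cost c S x \<noteq> {}" using cost_w[OF x(1)] h_pos by auto
      then have "\<not> inj_on c (N x \<inter> S)"
        using not_inj_if_cost_nonempty[of c S x] m D_ge val by (simp add: valid_def)
      then show ?thesis unfolding eq using card_uniques_less(2)[of "N x \<inter> S" c] m by simp
    qed
  qed
  define B where "B = c ` (N x \<inter> S0) \<union> (\<Union>w\<in>N x. K w)"
  have finB: "finite B" by (simp add: B_def K_def)
  have "card B \<le> D - 2 + h * (D - 1)"
  proof -
    have "(\<Union>w\<in>N x. K w) = (\<Union>w\<in>N x - {u}. K w)" by (auto simp: K_def)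
    then have "card (\<Union>w\<in>N x. K w) \<le> (\<Sum>w\<in>N x - {u}. card (K w))"
      using card_UN_le[of "N x - {u}" K] by simp
    also have "\<dots> \<le> (\<Sum>w\<in>N x - {u}. h)" using card_K by (intro sum_mono) auto
    also have "\<dots> \<le> h * (D - 1)" using u_Nx deg_le[of x] by (simp add: diff_le_mono)
    finally show ?thesis
      unfolding B_def using card_Un_le[of "c ` (N x \<inter> S0)" "\<Union>w\<in>N x. K w"] im_x by linarith
  qed
  then have "card (insert \<alpha> B) \<le> D - 1 + h * (D - 1)"
    using card_insert_le_m1[of "D - 1 + h * (D - 1)" B \<alpha>] D_ge by (simp add: card_insert_if finB)
  also have "\<dots> < card X" using D_ge h_pos unfolding card_X_eq by (cases D) (auto simp: algebra_simps)
  finally have "\<not> X \<subseteq> insert \<alpha> B" using card_mono[of "insert \<alpha> B" X] finB by auto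
  then obtain b where b: "b \<in> X" "b \<noteq> \<alpha>" "b \<notin> B" by blast
  define c1 where "c1 = c(x := b)"
  have "b \<notin> blocked c S0 x" using b cost_K unfolding blocked_def B_def by blast
  then have val1: "valid c1 S"
    unfolding c1_def using valid_extend[OF val0 xS0(3) xS0(1) b(1)] xS0(2) by simp
  have "\<alpha> \<notin> c1 ` (N u \<inter> S)"
    using inj_u x b unfolding c1_def \<alpha>_def by (auto dest: inj_onD)
  moreover have "\<alpha> \<notin> cost c1 S w" if w: "w \<in> N u" for w
  proof (cases "x \<in> N w")
    case False
    then have 1: "uniques c1 (N w \<inter> S) = uniques c (N w \<inter> S)"
      by (intro uniques_cong) (auto simp: c1_def)
    have 2: "c1 ` (N w \<inter> S) = c ` (N w \<inter> S)"
      using False by (intro image_cong) (auto simp: c1_def)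
    show ?thesis using \<alpha>_cost[OF w] unfolding cost_def 1 2 .
  next
    case True
    note t = triangle[OF w True]
    have K: "K w = uniques c (N w \<inter> S)" using w irrefl by (auto simp: K_def)
    have bK: "b \<notin> uniques c (N w \<inter> S)"
      using b(3) True sym K unfolding B_def by blast
    then have b0: "b \<notin> uniques c (N w \<inter> S0)" using t(4) b(2) by auto
    have uq0: "uniques c1 (N w \<inter> S0) = uniques c (N w \<inter> S0)"
      using xS0 by (intro uniques_cong) (auto simp: c1_def)
    \<comment> \<open>The new color \<open>b\<close> of \<open>x\<close> is not unique on
      \<open>N w \<inter> S0\<close>, so it destroys no unique color there.\<close>
    have sup: "uniques c (N w \<inter> S0) \<subseteq> uniques c1 (N w \<inter> S)"
    proof (cases "b \<in> c ` (N w \<inter> S0)")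
      case True
      have "c1 x \<in> c1 ` (N w \<inter> S0)" using True xS0 by (auto simp: c1_def)
      then show ?thesis
        unfolding t(1) using uniques_insert_old[OF t(2)] uq0 b0 by (simp add: c1_def)
    next
      case False
      have "c1 x \<notin> c1 ` (N w \<inter> S0)" using False xS0 by (auto simp: c1_def)
      then show ?thesis
        unfolding t(1) using uniques_insert_new[OF t(2)] uq0 by (simp add: subset_insertI)
    qed
    have ch: "card (uniques c (N w \<inter> S)) = h" using cost_plain[OF w True] by simp
    \<comment> \<open>If \<open>\<alpha>\<close> occurs just once besides at \<open>x\<close>, then
      \<open>w\<close> now has \<open>h + 1\<close> unique colors and excludes nothing. Otherwise
      \<open>\<alpha>\<close> stays non-unique, and \<open>w\<close> excludes at most unique
      colors.\<close>
    show ?thesis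
    proof (cases "\<alpha> \<in> uniques c (N w \<inter> S0)")
      case True
      then have "card (uniques c (N w \<inter> S0)) = h + 1"
        using ch t(4) card_Suc_Diff1[OF _ True] by simp
      then have "h < card (uniques c1 (N w \<inter> S))"
        using card_mono[OF _ sup] by simp
      then show ?thesis by (simp add: cost_def)
    next
      case False
      then have "card (uniques c (N w \<inter> S0)) = h" using ch t(4) by simp
      then have ge: "h \<le> card (uniques c1 (N w \<inter> S))" using card_mono[OF _ sup] by simp
      have "\<alpha> \<notin> uniques c1 (N w \<inter> S)"
      proof
        assume "\<alpha> \<in> uniques c1 (N w \<inter> S)"
        moreover have "c1 x \<noteq> \<alpha>" using b by (simp add: c1_def)
        ultimately have "\<alpha> \<in> uniques c1 (N w \<inter> S0)"
          unfolding t(1) by (auto simp: uniques_iff)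
        then show False using uq0 False by simp
      qed
      then show ?thesis using ge by (auto simp: cost_def)
    qed
  qed
  ultimately have "\<alpha> \<notin> blocked c1 S u" by (simp add: blocked_def)
  moreover have "\<alpha> \<in> X" using val x by (auto simp: valid_def \<alpha>_def)
  ultimately have "valid (c1(u := \<alpha>)) (insert u S)"
    using valid_extend[OF val1 u] by blast
  moreover have "valid (c1(u := \<alpha>)) S"
    using val1 valid_cong[of S c1 "c1(u := \<alpha>)"] u by (metis fun_upd_other)
  ultimately show ?thesis by blast
qed

text \<open>Validity on \<open>S\<close> as well records that \<open>u\<close> is removable, which
  the next vertex needs of a colored neighbor in case it is stuck.\<close>

lemma valid_step:
  assumes val: "valid c S" and u: "u \<in> V" "u \<notin> S" and p: "p \<in> N u" "p \<notin> S"
    and x: "N u \<inter> S = {} \<or> (\<exists>x\<in>N u \<inter> S. valid c (S - {x}))"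
  shows "\<exists>c'. valid c' (insert u S) \<and> valid c' S"
proof -
  have ext: "\<exists>c'. valid c' (insert u S) \<and> valid c' S" if "valid (c(u := a)) (insert u S)" for a
    using that val valid_cong[of S c "c(u := a)"] u by (metis fun_upd_other)
  show ?thesis
  proof (cases "X \<subseteq> blocked c S u")
    case False
    then show ?thesis using valid_extend[OF val u] ext by blast
  next
    case True
    from x show ?thesis
    proof
      assume "N u \<inter> S = {}"
      then show ?thesis using valid_extend_low_degree[OF val u] ext by blast
    next
      assume "\<exists>x\<in>N u \<inter> S. valid c (S - {x})"
      then show ?thesis using valid_recolor_extend[OF val u p _ _ _ True] by blast
    qed
  qed
qed

section \<open>Depth-first coloring order\<close>

definition steps :: "'a set \<Rightarrow> ('a \<times> 'a) set" where
  "steps C = {(a, b). b \<in> N a \<and> b \<in> C}"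

text \<open>\<open>P\<close> stays uncolored. For a neighbor \<open>x\<close> in \<open>C\<close> of
  some \<open>p\<close> in \<open>P\<close>, with \<open>E\<close> the part of \<open>C\<close>
  reachable from \<open>x\<close>, the induction colors \<open>C - E\<close> toward
  \<open>P\<close>, next \<open>E - {x}\<close> toward \<open>x\<close>, and finally
  \<open>x\<close>, with \<open>p\<close> as its uncolored neighbor. The conclusion hands the caller
  a removable neighbor of a root. As \<open>S\<close> has no edges to \<open>C\<close>, the colored
  neighbors of \<open>x\<close> all lie in \<open>E - {x}\<close>.\<close>

lemma valid_extend_toward:
  assumes "finite C" "valid c S" "S \<union> C \<union> P \<subseteq> V" "C \<inter> P = {}" "S \<inter> P = {}" "S \<inter> C = {}"
    and "\<And>v. v \<in> C \<Longrightarrow> N v \<inter> S = {}"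
    and "\<And>v. v \<in> C \<Longrightarrow> \<exists>p\<in>P. (p, v) \<in> (steps C)\<^sup>*"
  shows "\<exists>c'. valid c' (S \<union> C) \<and>
    (C \<noteq> {} \<longrightarrow> (\<exists>p\<in>P. \<exists>x\<in>C. x \<in> N p \<and> valid c' (S \<union> C - {x})))"
  using assms
proof (induction "card C" arbitrary: C c S P rule: less_induct)
  case less
  show ?case
  proof (cases "C = {}")
    case True
    then show ?thesis using less.prems by auto
  next
    case False
    then obtain v p where v: "v \<in> C" "p \<in> P" "(p, v) \<in> (steps C)\<^sup>*" using less.prems(8) by blast
    then have "p \<noteq> v" using less.prems(4) by auto
    with v(3) obtain x where "(p, x) \<in> steps C" by (meson converse_rtranclE)
    then have x: "x \<in> N p" "x \<in> C" by (auto simp: steps_def)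
    define E where "E = {v. (x, v) \<in> (steps C)\<^sup>*}"
    define C' where "C' = C - E"
    have E_C: "E \<subseteq> C"
    proof
      fix v assume "v \<in> E"
      then have "(x, v) \<in> (steps C)\<^sup>*" by (simp add: E_def)
      then show "v \<in> C" by (induction) (auto simp: x steps_def)
    qed
    have xE: "x \<in> E" by (simp add: E_def)
    have E_closed: "z \<in> E" if "v \<in> E" "z \<in> N v" "z \<in> C" for v z
    proof -
      have "(v, z) \<in> steps C" using that by (simp add: steps_def)
      then show ?thesis using that(1) unfolding E_def by (auto intro: rtrancl_into_rtrancl)
    qed
    have "C' \<subset> C" using x xE by (auto simp: C'_def)
    then have small: "card C' < card C" using less.prems(1) by (simp add: psubset_card_mono)
    \<comment> \<open>A walk inside \<open>C\<close> cannot leave \<open>E\<close> again, so a walk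
      ending outside \<open>E\<close> avoids it.\<close>
    have reach1: "\<exists>p\<in>P. (p, v) \<in> (steps C')\<^sup>*" if v: "v \<in> C'" for v
    proof -
      obtain p where p: "p \<in> P" "(p, v) \<in> (steps C)\<^sup>*" using less.prems(8) v by (auto simp: C'_def)
      from p(2) have "v \<in> E \<or> (p, v) \<in> (steps C')\<^sup>*"
      proof (induction)
        case (step y z)
        then have z: "z \<in> N y" "z \<in> C" by (auto simp: steps_def)
        show ?case
        proof (cases "z \<in> E")
          case False
          then have "y \<notin> E" using E_closed z by blast
          moreover have "(y, z) \<in> steps C'" using z False by (simp add: steps_def C'_def)
          ultimately show ?thesis using step.IH by (auto intro: rtrancl_into_rtrancl)
        qed simp
      qed simp
      then show ?thesis using p v by (auto simp: C'_def)
    qed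
    have "\<exists>c'. valid c' (S \<union> C') \<and>
        (C' \<noteq> {} \<longrightarrow> (\<exists>p\<in>P. \<exists>y\<in>C'. y \<in> N p \<and> valid c' (S \<union> C' - {y})))"
      by (rule less.hyps[OF small]) (use less.prems reach1 in \<open>auto simp: C'_def\<close>)
    then obtain c1 where c1: "valid c1 (S \<union> C')" by blast
    have "E - {x} \<subset> C" using x xE E_C by auto
    then have small2: "card (E - {x}) < card C" using less.prems(1) by (simp add: psubset_card_mono)
    \<comment> \<open>Cut the walk at its last visit to \<open>x\<close>.\<close>
    have reach2: "(x, v) \<in> (steps (E - {x}))\<^sup>*" if "v \<in> E" for v
    proof -
      from that have "(x, v) \<in> (steps C)\<^sup>*" by (simp add: E_def)
      then show ?thesis
      proof (induction)
        case (step y z)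
        show ?case
        proof (cases "z = x")
          case False
          have "z \<in> E" unfolding E_def using step.hyps by (auto intro: rtrancl_into_rtrancl)
          then have "(y, z) \<in> steps (E - {x})" using step.hyps False by (simp add: steps_def)
          then show ?thesis using step.IH by (auto intro: rtrancl_into_rtrancl)
        qed simp
      qed simp
    qed
    define S' where "S' = S \<union> C'"
    have "\<exists>c'. valid c' (S' \<union> (E - {x})) \<and> (E - {x} \<noteq> {} \<longrightarrow>
        (\<exists>p\<in>{x}. \<exists>y\<in>E - {x}. y \<in> N p \<and> valid c' (S' \<union> (E - {x}) - {y})))"
    proof (rule less.hyps[OF small2])
      show "finite (E - {x})" using less.prems(1) E_C finite_subset by blast
      show "valid c1 S'" using c1 by (simp add: S'_def)
      show "S' \<union> (E - {x}) \<union> {x} \<subseteq> V" using less.prems(3) E_C x by (auto simp: S'_def C'_def)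
      show "(E - {x}) \<inter> {x} = {}" by simp
      show "S' \<inter> {x} = {}" using less.prems(6) x xE by (auto simp: S'_def C'_def)
      show "S' \<inter> (E - {x}) = {}" using less.prems(6) E_C by (auto simp: S'_def C'_def)
      show "N v \<inter> S' = {}" if "v \<in> E - {x}" for v
        using that less.prems(7)[of v] E_C E_closed[of v] by (auto simp: S'_def C'_def)
      show "\<exists>p\<in>{x}. (p, v) \<in> (steps (E - {x}))\<^sup>*" if "v \<in> E - {x}" for v
        using that reach2 by simp
    qed
    then obtain c2 where c2: "valid c2 (S' \<union> (E - {x}))"
      and c2': "E - {x} \<noteq> {} \<longrightarrow> (\<exists>y\<in>E - {x}. y \<in> N x \<and> valid c2 (S' \<union> (E - {x}) - {y}))"
      by auto
    have eq: "S' \<union> (E - {x}) = S \<union> C - {x}"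
      using E_C x xE less.prems(6) by (auto simp: S'_def C'_def)
    have ins: "insert x (S \<union> C - {x}) = S \<union> C" using x by auto
    have nb: "N x \<inter> (S \<union> C - {x}) \<subseteq> E - {x}"
      using less.prems(7)[OF x(2)] E_closed[OF xE] by auto
    have "\<exists>c'. valid c' (insert x (S \<union> C - {x})) \<and> valid c' (S \<union> C - {x})"
    proof (rule valid_step)
      show "valid c2 (S \<union> C - {x})" using c2 eq by simp
      show "x \<in> V" using x less.prems(3) by auto
      show "p \<in> N x" using x sym by blast
      show "p \<notin> S \<union> C - {x}" using v(2) less.prems(4,5) by auto
      show "N x \<inter> (S \<union> C - {x}) = {} \<or>
          (\<exists>y\<in>N x \<inter> (S \<union> C - {x}). valid c2 (S \<union> C - {x} - {y}))"
      proof (cases "E - {x} = {}")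
        case True
        then show ?thesis using nb by auto
      next
        case False
        then show ?thesis using c2' eq by auto
      qed
    qed simp
    then show ?thesis using ins x v(2) by metis
  qed
qed

subsection \<open>Shortest cycles\<close>

definition cyc :: "nat \<Rightarrow> (nat \<Rightarrow> 'a) \<Rightarrow> bool" where
  "cyc l q \<longleftrightarrow> 3 \<le> l \<and> inj_on q {..<l} \<and> (\<forall>i<l. q (csucc l i) \<in> N (q i))"

lemma cycI:
  assumes "3 \<le> l" "inj_on q {..<l}" "\<And>i. i + 1 < l \<Longrightarrow> q (i + 1) \<in> N (q i)" "q 0 \<in> N (q (l - 1))"
  shows "cyc l q"
proof -
  have "q (csucc l i) \<in> N (q i)" if "i < l" for i
    using assms that by (cases "i + 1 = l") (auto simp: csucc_def)
  then show ?thesis using assms by (simp add: cyc_def)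
qed

text \<open>All neighbors of the end of a longest path lie on the path, and one that is not the
  preceding vertex closes a cycle.\<close>

lemma cyc_exists:
  assumes ne: "V \<noteq> {}" and deg: "\<And>v. v \<in> V \<Longrightarrow> 2 \<le> card (N v)"
  shows "\<exists>l q. cyc l q"
proof -
  define path where "path n q \<longleftrightarrow> 1 \<le> n \<and> inj_on q {..<n} \<and> q ` {..<n} \<subseteq> V \<and>
      (\<forall>i. i + 1 < n \<longrightarrow> q (i + 1) \<in> N (q i))" for n and q :: "nat \<Rightarrow> 'a"
  obtain v0 where v0: "v0 \<in> V" using ne by blast
  have p1: "\<exists>q. path 1 q" using v0 by (intro exI[of _ "\<lambda>_. v0"]) (auto simp: path_def inj_on_def)
  have bound: "n \<le> card V" if ex: "\<exists>q. path n q" for n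
  proof -
    obtain q where q: "inj_on q {..<n}" "q ` {..<n} \<subseteq> V" using ex by (auto simp: path_def)
    then show ?thesis using card_mono[OF finite_V q(2)] by (simp add: card_image)
  qed
  define n where "n = (GREATEST n. \<exists>q. path n q)"
  have "\<exists>q. path n q"
    unfolding n_def using GreatestI_nat[of "\<lambda>n. \<exists>q. path n q" 1 "card V"] p1 bound by blast
  moreover have n: "m \<le> n" if "\<exists>q. path m q" for m
    unfolding n_def using Greatest_le_nat[of "\<lambda>n. \<exists>q. path n q" m "card V"] that bound by blast
  ultimately obtain q where q: "path n q" by blast
  then have q': "1 \<le> n" "inj_on q {..<n}" "q ` {..<n} \<subseteq> V" "\<And>i. i + 1 < n \<Longrightarrow> q (i + 1) \<in> N (q i)"
    by (auto simp: path_def)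
  define v where "v = q (n - 1)"
  have sub: "N v \<subseteq> q ` {..<n}"
  proof
    fix y assume y: "y \<in> N v"
    show "y \<in> q ` {..<n}"
    proof (rule ccontr)
      assume ny: "y \<notin> q ` {..<n}"
      have "path (n + 1) (q(n := y))"
        unfolding path_def
      proof (intro conjI allI impI)
        show "inj_on (q(n := y)) {..<n + 1}"
          using q'(2) ny by (auto simp: inj_on_def less_Suc_eq image_iff)
        show "q(n := y) ` {..<n + 1} \<subseteq> V"
          using q'(3) y N_sub by (auto simp: less_Suc_eq)
        fix i assume "i + 1 < n + 1"
        then consider "i + 1 < n" | "i = n - 1" "i + 1 = n" by linarith
        then show "(q(n := y)) (i + 1) \<in> N ((q(n := y)) i)"
          using q'(4)[of i] y by cases (auto simp: v_def)
      qed simp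
      then show False using n[of "n + 1"] by auto
    qed
  qed
  have "v \<in> V" using q' by (auto simp: v_def)
  then have "card {q (n - 2)} < card (N v)" using deg[of v] by simp
  then obtain y where y: "y \<in> N v" "y \<noteq> q (n - 2)"
    using exists_in_diff[of "{q (n - 2)}" "N v"] by auto
  then obtain j where j: "j < n" "y = q j" using sub by auto
  have "j \<noteq> n - 1" using y j irrefl by (auto simp: v_def)
  moreover have "j \<noteq> n - 2" using y j by auto
  ultimately have j3: "j + 3 \<le> n" using j by linarith
  have "cyc (n - j) (\<lambda>i. q (j + i))"
  proof (rule cycI)
    show "3 \<le> n - j" using j3 by simp
    show "inj_on (\<lambda>i. q (j + i)) {..<n - j}"
      by (rule inj_on_shift[OF q'(2)]) (use j in simp)
    show "q (j + (i + 1)) \<in> N (q (j + i))" if "i + 1 < n - j" for i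
      using q'(4)[of "j + i"] that by simp
    have "j + (n - j - 1) = n - 1" using j by simp
    then show "q (j + 0) \<in> N (q (j + (n - j - 1)))" using y j by (simp add: v_def)
  qed
  then show ?thesis by blast
qed

text \<open>A chord cuts off a shorter cycle. An outside vertex with neighbors at positions
  \<open>a < b\<close> closes a cycle of length \<open>b - a + 2\<close>, so \<open>b - a\<close> is
  at least \<open>l - 2\<close>. Three such positions give two consecutive gaps, and
  \<open>2 * (l - 2) \<le> l - 1\<close> forces \<open>l = 3\<close>.\<close>

lemma shortest_cycle:
  assumes ne: "V \<noteq> {}" and deg: "\<And>v. v \<in> V \<Longrightarrow> 2 \<le> card (N v)"
  obtains l q where "cyc l q"
    "\<And>i. i < l \<Longrightarrow> N (q i) \<inter> q ` {..<l} = {q (cpred l i), q (csucc l i)}"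
    "\<And>w. w \<notin> q ` {..<l} \<Longrightarrow> card (N w \<inter> q ` {..<l}) \<le> 2 \<or> l = 3"
proof -
  define l where "l = (LEAST l. \<exists>q. cyc l q)"
  obtain l0 q0 where "cyc l0 q0" using cyc_exists[OF assms] by blast
  then have "\<exists>q. cyc l q" unfolding l_def by (intro LeastI[of "\<lambda>l. \<exists>q. cyc l q" l0]) blast
  then obtain q where q: "cyc l q" by blast
  have least: "l \<le> l'" if "cyc l' q'" for l' q'
    unfolding l_def using that by (blast intro: Least_le)
  have l: "3 \<le> l" and inj: "inj_on q {..<l}" and nxt: "\<And>i. i < l \<Longrightarrow> q (csucc l i) \<in> N (q i)"
    using q by (auto simp: cyc_def)
  have nxt1: "q (i + 1) \<in> N (q i)" if "i + 1 < l" for i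
    using nxt[of i] that by (simp add: csucc_def)
  have chord: "b = a + 1 \<or> a = 0 \<and> b = l - 1" if ab: "a < b" "b < l" "q b \<in> N (q a)" for a b
  proof (rule ccontr)
    assume not: "\<not> (b = a + 1 \<or> a = 0 \<and> b = l - 1)"
    have "cyc (b - a + 1) (\<lambda>i. q (a + i))"
    proof (rule cycI)
      show "3 \<le> b - a + 1" using not ab by linarith
      show "inj_on (\<lambda>i. q (a + i)) {..<b - a + 1}"
        by (rule inj_on_shift[OF inj]) (use ab in simp)
      show "q (a + (i + 1)) \<in> N (q (a + i))" if "i + 1 < b - a + 1" for i
        using nxt1[of "a + i"] that ab by simp
      show "q (a + 0) \<in> N (q (a + (b - a + 1 - 1)))" using ab sym by simp
    qed
    from least[OF this] show False using not ab by linarith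
  qed
  have nb: "N (q i) \<inter> q ` {..<l} = {q (cpred l i), q (csucc l i)}" if i: "i < l" for i
  proof
    show "{q (cpred l i), q (csucc l i)} \<subseteq> N (q i) \<inter> q ` {..<l}"
      using nxt[OF i] nxt[OF cpred_less[OF i]] csucc_cpred[OF i] cpred_less[OF i] csucc_less[OF i] sym
      by auto
    show "N (q i) \<inter> q ` {..<l} \<subseteq> {q (cpred l i), q (csucc l i)}"
    proof
      fix y assume "y \<in> N (q i) \<inter> q ` {..<l}"
      then obtain j where j: "j < l" "y = q j" "q j \<in> N (q i)" by auto
      have "j \<noteq> i" using j irrefl by auto
      then consider "i < j" | "j < i" by linarith
      then have "j = cpred l i \<or> j = csucc l i"
      proof cases
        case 1
        then show ?thesis using chord[OF 1 j(1,3)] i j by (auto simp: csucc_def cpred_def)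
      next
        case 2
        then show ?thesis using chord[OF 2 i] j sym l by (auto simp: csucc_def cpred_def)
      qed
      then show "y \<in> {q (cpred l i), q (csucc l i)}" using j by auto
    qed
  qed
  have detour: "l \<le> b - a + 2" if w: "w \<notin> q ` {..<l}" and ab: "a < b" "b < l" "q a \<in> N w" "q b \<in> N w"
    for w a b
  proof -
    have "cyc (b - a + 2) (\<lambda>i. if i = 0 then w else q (a + i - 1))"
    proof (rule cycI)
      show "3 \<le> b - a + 2" using ab by simp
      show "inj_on (\<lambda>i. if i = 0 then w else q (a + i - 1)) {..<b - a + 2}"
      proof (rule inj_onI)
        fix x y assume xy: "x \<in> {..<b - a + 2}" "y \<in> {..<b - a + 2}"
          "(if x = 0 then w else q (a + x - 1)) = (if y = 0 then w else q (a + y - 1))"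
        have in_l: "z = 0 \<or> a + z - 1 < l" if "z \<in> {..<b - a + 2}" for z
          using that ab by auto
        then have out: "z = 0 \<or> q (a + z - 1) \<noteq> w" if "z \<in> {..<b - a + 2}" for z
          using that w by (metis imageI lessThan_iff)
        show "x = y"
        proof (cases "x = 0 \<or> y = 0")
          case True
          then show ?thesis using xy out[of x] out[of y] by (auto split: if_splits)
        next
          case False
          then have "a + x - 1 = a + y - 1"
            using xy in_l[of x] in_l[of y] inj_onD[OF inj] by auto
          then show ?thesis using False by linarith
        qed
      qed
      show "(if i + 1 = 0 then w else q (a + (i + 1) - 1)) \<in> N (if i = 0 then w else q (a + i - 1))"
        if "i + 1 < b - a + 2" for i
        using that ab nxt1[of "a + i - 1"] by (cases "i = 0") auto
      have "a + (b - a + 2 - 1) - 1 = b" using ab by simp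
      then show "(if 0 = (0 :: nat) then w else q (a + 0 - 1)) \<in>
          N (if b - a + 2 - 1 = 0 then w else q (a + (b - a + 2 - 1) - 1))"
        using ab sym by simp
    qed
    from least[OF this] show ?thesis .
  qed
  have "card (N w \<inter> q ` {..<l}) \<le> 2 \<or> l = 3" if w: "w \<notin> q ` {..<l}" for w
  proof (rule ccontr)
    assume not: "\<not> ?thesis"
    define I where "I = {i. i < l \<and> q i \<in> N w}"
    have "N w \<inter> q ` {..<l} = q ` I" by (auto simp: I_def)
    moreover have "card (q ` I) = card I"
      using inj by (intro card_image) (auto simp: I_def inj_on_def)
    ultimately have cI: "3 \<le> card I" using not by simp
    have finI: "finite I" by (simp add: I_def)
    have gap: "l \<le> b - a + 2" if "a \<in> I" "b \<in> I" "a < b" for a b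
      using detour[OF w that(3)] that by (simp add: I_def)
    define a where "a = Min I"
    have aI: "a \<in> I" using cI finI by (auto simp: a_def intro!: Min_in)
    have "card (I - {a}) \<ge> 2" using cI aI by simp
    then have "card (I - {a}) > 1" by simp
    then obtain b c where bc: "b \<in> I - {a}" "c \<in> I - {a}" "b \<noteq> c"
      using finI by (metis card_le_Suc0_iff_eq finite_Diff not_le One_nat_def)
    have lt: "a < x" if "x \<in> I - {a}" for x
      using that finI by (metis DiffE a_def le_neq_implies_less Min_le singletonI)
    have "l \<le> b - a + 2" "l \<le> c - a + 2" using gap aI bc lt by auto
    moreover have "b < l" "c < l" using bc by (auto simp: I_def)
    moreover have "l \<le> b - c + 2 \<or> l \<le> c - b + 2" using gap[of b c] gap[of c b] bc by (metis DiffE linorder_neqE_nat)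
    moreover have "4 \<le> l" using not l by auto
    ultimately show False using bc(3) by linarith
  qed
  then show ?thesis using that[OF q nb] by blast
qed

subsection \<open>Coloring the cycle\<close>

definition pcf :: "('a \<Rightarrow> nat) \<Rightarrow> bool" where
  "pcf c \<longleftrightarrow> c ` V \<subseteq> X \<and> (\<forall>u\<in>V. \<forall>v\<in>N u. c u \<noteq> c v) \<and>
     (\<forall>w\<in>V. min (card (N w)) h \<le> card (uniques c (N w)))"

text \<open>A tolerated coincidence does no harm in the end: \<open>h + 2\<close> neighbors with at
  least \<open>h + 1\<close> colors have at least \<open>h\<close> unique ones.\<close>

lemma pcf_if_valid:
  assumes "valid c V"
  shows "pcf c"
proof -
  have eq: "N w \<inter> V = N w" for w using N_sub by blast
  have "min (card (N w)) h \<le> card (uniques c (N w))" for w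
    using assms two_image_le_card_add_uniques[of "N w" c] unfolding valid_def okay_def eq by force
  then show ?thesis using assms by (simp add: pcf_def valid_def eq)
qed

text \<open>\<open>K\<close> is what the neighbors of \<open>w\<close> in \<open>P\<close> avoid to
  leave \<open>w\<close> with \<open>h\<close> unique colors: nothing if \<open>w\<close> can lose
  one color per such neighbor, else \<open>h\<close> unique colors, or every color seen when fewer
  than \<open>h\<close> are unique. If fewer than \<open>h\<close> neighbors are colored, the degree
  forces three in \<open>P\<close>, and injectivity is needed on them.\<close>

lemma outside_colors:
  assumes val: "valid c S" and reg: "card (N w) = D" and part: "N w \<subseteq> S \<union> P" "S \<inter> P = {}"
    and few: "card (N w \<inter> P) \<le> 3"
  shows "\<exists>K. finite K \<and> card K \<le> h \<and> (\<forall>g. (\<forall>u\<in>S. g u = c u) \<longrightarrow> g ` (N w \<inter> P) \<inter> K = {} \<longrightarrow>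
    card (N w \<inter> P) \<le> 2 \<or> inj_on g (N w \<inter> P) \<longrightarrow> h \<le> card (uniques g (N w)))"
proof -
  let ?A = "N w \<inter> S" and ?B = "N w \<inter> P"
  have AB: "N w = ?A \<union> ?B" "?A \<inter> ?B = {}" using part by auto
  have m: "card ?A + card ?B = D"
    using reg card_Un_disjoint[OF _ _ AB(2)] AB(1) by simp
  have sup: "uniques c ?A - g ` ?B \<subseteq> uniques g (N w)" if "\<forall>u\<in>S. g u = c u" for g
    using uniques_Un_superset[of ?A g c ?B] that AB(1) by simp
  have ok: "okay c S w" using val by (simp add: valid_def)
  consider (rich) "h + card ?B \<le> card (uniques c ?A)"
    | (plain) "card (uniques c ?A) < h + card ?B" "h \<le> card (uniques c ?A)"
    | (few) "card ?A < h" "card ?A \<le> card (uniques c ?A)"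
    | (pair) "card (uniques c ?A) < h" "card (uniques c ?A) < card ?A"
    using ok by (cases "h \<le> card (uniques c ?A)"; cases "card ?A \<le> card (uniques c ?A)"; linarith)
  then show ?thesis
  proof cases
    case rich
    have "h \<le> card (uniques g (N w))" if g: "\<forall>u\<in>S. g u = c u" for g
    proof -
      have "card (uniques c ?A) - card (g ` ?B) \<le> card (uniques c ?A - g ` ?B)"
        by (intro diff_card_le_card_Diff) simp
      also have "\<dots> \<le> card (uniques g (N w))" using sup[OF g] by (intro card_mono) auto
      finally show ?thesis using rich card_image_le[of ?B g] by simp
    qed
    then show ?thesis by (intro exI[of _ "{}"]) simp
  next
    case plain
    obtain T where T: "T \<subseteq> uniques c ?A" "card T = h" "finite T"
      using obtain_subset_with_card_n[OF plain(2)] by blast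
    have "h \<le> card (uniques g (N w))" if g: "\<forall>u\<in>S. g u = c u" "g ` ?B \<inter> T = {}" for g
    proof -
      have "T \<subseteq> uniques g (N w)" using T(1) sup[OF g(1)] g(2) by blast
      then show ?thesis using T(2) card_mono[of "uniques g (N w)" T] by simp
    qed
    then show ?thesis using T by (intro exI[of _ T]) simp
  next
    case few
    have inj: "inj_on c ?A" using few(2) card_uniques_less[of ?A c] by fastforce
    have "h \<le> card (uniques g (N w))"
      if g: "\<forall>u\<in>S. g u = c u" "g ` ?B \<inter> c ` ?A = {}" "card ?B \<le> 2 \<or> inj_on g ?B" for g
    proof -
      have "inj_on g ?B" using g(3) few m D_ge by linarith
      moreover have gc: "g ` ?A = c ` ?A" "inj_on g ?A"
        using g(1) inj by (auto simp: inj_on_def)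
      ultimately have "inj_on g (?A \<union> ?B)" using g(2) by (auto simp: inj_on_Un)
      then have "inj_on g (N w)" using AB(1) by simp
      then show ?thesis using reg D_ge by (simp add: uniques_inj_on card_image)
    qed
    moreover have "card (c ` ?A) \<le> h" using few card_image_le[of ?A c] by simp
    ultimately show ?thesis by (intro exI[of _ "c ` ?A"]) simp
  next
    case pair
    have ok2: "card (N w) = h + 2" "h + 1 \<le> card ?A" "card ?A \<le> card (c ` ?A) + 1"
      using ok pair unfolding okay_def by linarith+
    have ninj: "\<not> inj_on c ?A" using pair by (auto simp: uniques_inj_on card_image)
    have two: "2 * card (c ` ?A) \<le> card ?A + card (uniques c ?A)"
      using two_image_le_card_add_uniques[of ?A c] by simp
    have cA: "card ?A = h + 1" using ok2 two pair m reg by linarith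
    then have cB: "card ?B = 1" using ok2 m reg by linarith
    then obtain x where x: "?B = {x}" by (auto simp: card_1_singleton_iff)
    have "h \<le> card (uniques g (N w))" if g: "\<forall>u\<in>S. g u = c u" "g ` ?B \<inter> c ` ?A = {}" for g
    proof -
      have gx: "g x \<notin> c ` ?A" using g(2) x by auto
      have "g x \<in> uniques g (?A \<union> ?B)"
        by (rule mem_uniques_Un[of _ _ c]) (use g x gx in auto)
      moreover have "uniques c ?A \<subseteq> uniques g (N w)"
        using sup[OF g(1)] g(2) uniques_subset[of c ?A] by blast
      ultimately have "insert (g x) (uniques c ?A) \<subseteq> uniques g (N w)" using AB(1) by simp
      then have "card (insert (g x) (uniques c ?A)) \<le> card (uniques g (N w))" by (intro card_mono) auto
      moreover have "g x \<notin> uniques c ?A" using gx uniques_subset by blast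
      ultimately show ?thesis using two ok2 cA by simp
    qed
    moreover have "card (c ` ?A) \<le> h" using card_uniques_less(2)[OF _ ninj] cA by simp
    ultimately show ?thesis by (intro exI[of _ "c ` ?A"]) simp
  qed
qed

lemma pcf_on_cycle:
  assumes cyc: "cyc l q"
    and nb: "\<And>i. i < l \<Longrightarrow> N (q i) \<inter> q ` {..<l} = {q (cpred l i), q (csucc l i)}"
    and out: "\<And>w. w \<notin> q ` {..<l} \<Longrightarrow> card (N w \<inter> q ` {..<l}) \<le> 2 \<or> l = 3"
    and reg: "\<And>v. v \<in> V \<Longrightarrow> card (N v) = D"
    and val: "valid c (V - q ` {..<l})"
  shows "\<exists>c. pcf c"
proof -
  define P where "P = q ` {..<l}"
  define S where "S = V - P"
  have l: "3 \<le> l" and inj: "inj_on q {..<l}" and nxt: "\<And>i. i < l \<Longrightarrow> q (csucc l i) \<in> N (q i)"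
    using cyc by (auto simp: cyc_def)
  have P_V: "P \<subseteq> V"
  proof
    fix v assume "v \<in> P"
    then obtain i where "i < l" "v = q i" by (auto simp: P_def)
    then show "v \<in> V" using nxt[OF cpred_less] csucc_cpred N_sub by (metis subsetD)
  qed
  have part: "N w \<subseteq> S \<union> P" "S \<inter> P = {}" for w using N_sub by (auto simp: S_def)
  have val: "valid c S" using val by (simp add: S_def P_def)
  have few: "card (N w \<inter> P) \<le> 3" if "w \<in> S" for w
  proof (cases "l = 3")
    case True
    have "card (N w \<inter> P) \<le> card P" by (intro card_mono) (auto simp: P_def)
    also have "\<dots> \<le> 3" using card_image_le[of "{..<l}" q] True by (simp add: P_def)
    finally show ?thesis .
  next
    case False
    then show ?thesis using out[of w] that by (auto simp: S_def P_def)
  qed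
  have "\<forall>w\<in>S. \<exists>K. finite K \<and> card K \<le> h \<and> (\<forall>g. (\<forall>u\<in>S. g u = c u) \<longrightarrow> g ` (N w \<inter> P) \<inter> K = {} \<longrightarrow>
    card (N w \<inter> P) \<le> 2 \<or> inj_on g (N w \<inter> P) \<longrightarrow> h \<le> card (uniques g (N w)))"
    using outside_colors[OF val _ part few] reg by (auto simp: S_def)
  then obtain K where K: "\<And>w. w \<in> S \<Longrightarrow> finite (K w)" "\<And>w. w \<in> S \<Longrightarrow> card (K w) \<le> h"
    "\<And>w g. w \<in> S \<Longrightarrow> (\<forall>u\<in>S. g u = c u) \<Longrightarrow> g ` (N w \<inter> P) \<inter> K w = {} \<Longrightarrow>
      card (N w \<inter> P) \<le> 2 \<or> inj_on g (N w \<inter> P) \<Longrightarrow> h \<le> card (uniques g (N w))"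
    by metis
  define A where "A i = N (q i) \<inter> S" for i
  define L where "L i = X - c ` A i - (\<Union>w\<in>A i. K w)" for i
  have qV: "q i \<in> V" if "i < l" for i using that P_V by (auto simp: P_def)
  have NA: "N (q i) = A i \<union> {q (cpred l i), q (csucc l i)}" if i: "i < l" for i
    using nb[OF i] part(1)[of "q i"] by (auto simp: A_def P_def)
  have neq: "q (cpred l i) \<noteq> q (csucc l i)" if i: "i < l" for i
    using inj_onD[OF inj, of "cpred l i" "csucc l i"] csucc_less[OF i] cpred_less[OF i]
      csucc_neq_cpred[OF l i] by auto
  have finA: "finite (A i)" for i by (simp add: A_def)
  have cA: "card (A i) = D - 2" if i: "i < l" for i
  proof -
    have "A i \<inter> {q (cpred l i), q (csucc l i)} = {}"
      using nb[OF i] by (auto simp: A_def S_def P_def)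
    then have "card (N (q i)) = card (A i) + 2"
      unfolding NA[OF i] using neq[OF i] finA by (subst card_Un_disjoint) auto
    then show ?thesis using reg[OF qV[OF i]] by simp
  qed
  have uA: "h \<le> card (uniques c (A i))" if i: "i < l" for i
  proof -
    \<comment> \<open>The tolerated coincidence requires \<open>h + 1\<close> colored neighbors at
      degree \<open>h + 2\<close>, but two neighbors lie on the uncolored cycle.\<close>
    have "okay c S (q i)" using val by (simp add: valid_def)
    then show ?thesis using cA[OF i] D_ge reg[OF qV[OF i]] by (auto simp: okay_def A_def)
  qed
  interpret cycle_lists l h D L "\<lambda>i. c ` A i" "\<lambda>i. uniques c (A i)"
  proof
    fix i assume i: "i < l"
    show "finite (c ` A i)" using finA by simp
    show "uniques c (A i) \<subseteq> c ` A i" by (rule uniques_subset)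
    show "card (c ` A i) \<le> D - 2" using card_image_le[OF finA, of c i] cA[OF i] by simp
    show "h \<le> card (uniques c (A i))" by (rule uA[OF i])
    show "uniques c (A i) = c ` A i" if "card (c ` A i) = D - 2"
      using that cA[OF i] finA by (intro uniques_inj_on) (simp add: eq_card_imp_inj_on)
    show "card (uniques c (A i)) < card (c ` A i)" if "card (c ` A i) < D - 2"
      using that cA[OF i] finA card_image[of c "A i"] by (intro card_uniques_less(1)) auto
    show "2 * card (c ` A i) \<le> D - 2 + card (uniques c (A i))"
      using two_image_le_card_add_uniques[OF finA, of c i] cA[OF i] by simp
    show "L i \<inter> c ` A i = {}" by (auto simp: L_def)
    \<comment> \<open>Each of the \<open>D - 2\<close> outside neighbors withdraws at most
      \<open>h\<close> colors, and
      \<open>(h + 1) * D - 1 - h * (D - 2) = D - 1 + 2 * h\<close>.\<close>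
    have "card (\<Union>w\<in>A i. K w) \<le> (\<Sum>w\<in>A i. card (K w))" by (intro card_UN_le finA)
    also have "\<dots> \<le> (\<Sum>w\<in>A i. h)" using K(2) by (intro sum_mono) (auto simp: A_def)
    also have "\<dots> = h * (D - 2)" using cA[OF i] by simp
    finally have "card (\<Union>w\<in>A i. K w) \<le> h * (D - 2)" .
    moreover have "card X \<le> card (L i) + card (c ` A i) + card (\<Union>w\<in>A i. K w)"
      unfolding L_def using finA K(1) by (intro card_Diff_Diff_ge) (auto simp: A_def)
    moreover have "h * D = h * (D - 2) + 2 * h" using D_ge by (cases D; cases "D - 1") (auto simp: algebra_simps)
    ultimately show "D - 1 + 2 * h \<le> card (L i) + card (c ` A i)"
      using D_ge unfolding card_X_eq by linarith
  qed (use l h_pos D_ge in auto)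
  obtain g where g: "\<And>i. i < l \<Longrightarrow> good i (g (cpred l i)) (g i) (g (csucc l i))"
    using good_exists by blast
  have gL: "g i \<in> L i" "g i \<noteq> g (csucc l i)" if "i < l" for i
    using g[OF that] by (auto simp: good_def)
  define f where "f v = (if v \<in> P then g (the_inv_into {..<l} q v) else c v)" for v
  have fq: "f (q i) = g i" if "i < l" for i
    using that the_inv_into_f_f[OF inj, of i] by (simp add: f_def P_def)
  have fc: "f v = c v" if "v \<notin> P" for v using that by (simp add: f_def)
  have fS: "\<forall>u\<in>S. f u = c u" using fc by (auto simp: S_def)
  have fA: "f u = c u" if "u \<in> A i" for u i using that fS by (auto simp: A_def)
  have proper: "f u \<noteq> f v" if u: "u \<in> P" and v: "v \<in> N u" for u v
  proof -
    obtain i where i: "i < l" "u = q i" using u by (auto simp: P_def)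
    then consider "v \<in> A i" | "v = q (cpred l i)" | "v = q (csucc l i)" using v NA by auto
    then show ?thesis
    proof cases
      case 1
      then show ?thesis using gL(1)[OF i(1)] fq[OF i(1)] i fA[OF 1] by (auto simp: L_def)
    next
      case 2
      then show ?thesis
        using gL(2)[OF cpred_less[OF i(1)]] fq[OF i(1)] fq[OF cpred_less[OF i(1)]] i csucc_cpred[OF i(1)]
        by auto
    next
      case 3
      then show ?thesis using gL(2)[OF i(1)] fq[OF i(1)] fq[OF csucc_less[OF i(1)]] i by auto
    qed
  qed
  have "f ` V \<subseteq> X"
  proof
    fix a assume "a \<in> f ` V"
    then obtain v where v: "v \<in> V" "a = f v" by blast
    show "a \<in> X"
    proof (cases "v \<in> P")
      case True
      then obtain i where "i < l" "v = q i" by (auto simp: P_def)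
      then show ?thesis using gL(1)[of i] fq[of i] v by (simp add: L_def)
    next
      case False
      then show ?thesis using val v fc by (auto simp: valid_def S_def)
    qed
  qed
  moreover have "f u \<noteq> f v" if "u \<in> V" "v \<in> N u" for u v
  proof (cases "u \<in> P \<or> v \<in> P")
    case True
    then show ?thesis using proper[of u v] proper[of v u] that sym by metis
  next
    case False
    then have "u \<in> S" "v \<in> N u \<inter> S" using that N_sub by (auto simp: S_def)
    then show ?thesis using val False fc by (auto simp: valid_def)
  qed
  moreover have "h \<le> card (uniques f (N w))" if w: "w \<in> V" for w
  proof (cases "w \<in> P")
    case True
    then obtain i where i: "i < l" "w = q i" by (auto simp: P_def)
    let ?p = "cpred l i" and ?s = "csucc l i"
    let ?B = "{q ?p, q ?s}"
    have ps: "?p < l" "?s < l" using i cpred_less csucc_less by auto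
    have fB: "f ` ?B = {g ?p, g ?s}" using fq ps by simp
    have sup: "uniques c (A i) - {g ?p, g ?s} \<subseteq> uniques f (N w)"
      using uniques_Un_superset[of "A i" f c ?B] fA NA[OF i(1)] i(2) fB by simp
    have fin: "finite (uniques f (N w))" by simp
    have fresh: "h \<le> card (uniques f (N w))" if z: "z \<in> ?B" "f z \<notin> c ` A i" for z
    proof (cases "g ?p = g ?s")
      case True
      have "f z = g ?p" using z True fq ps by auto
      then have "uniques c (A i) - {g ?p, g ?s} = uniques c (A i)"
        using z True uniques_subset[of c "A i"] by auto
      then show ?thesis using uA[OF i(1)] card_mono[OF fin sup] by simp
    next
      case False
      have "f z \<in> uniques f (A i \<union> ?B)"
        by (rule mem_uniques_Un[of _ _ c]) (use fA z False fq ps in auto)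
      then have fz: "f z \<in> uniques f (N w)" using NA i by simp
      define y where "y = (if f z = g ?p then g ?s else g ?p)"
      have "f z = g ?p \<or> f z = g ?s" using z fq ps by auto
      then have gg: "{g ?p, g ?s} = {f z, y}" by (auto simp: y_def)
      have zU: "f z \<notin> uniques c (A i)" using z uniques_subset by blast
      have "insert (f z) (uniques c (A i) - {y}) \<subseteq> uniques f (N w)"
        using sup fz zU gg by auto
      then have "card (insert (f z) (uniques c (A i) - {y})) \<le> card (uniques f (N w))"
        by (rule card_mono[OF fin])
      moreover have "card (uniques c (A i)) \<le> card (insert (f z) (uniques c (A i) - {y}))"
        using zU finA by (auto simp: card_Diff_singleton_if)
      ultimately show ?thesis using uA[OF i(1)] by simp
    qed
    have "h \<le> card (uniques c (A i) - {g ?p, g ?s}) \<or> g ?p \<notin> c ` A i \<or> g ?s \<notin> c ` A i"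
      using g[OF i(1)] by (simp add: good_def)
    then show ?thesis
      using card_mono[OF fin sup] fresh[of "q ?p"] fresh[of "q ?s"] fq ps by auto
  next
    case False
    then have wS: "w \<in> S" using w by (simp add: S_def)
    have "f ` (N w \<inter> P) \<inter> K w = {}"
    proof -
      have "f v \<notin> K w" if v: "v \<in> N w \<inter> P" for v
      proof -
        obtain i where i: "i < l" "v = q i" using v by (auto simp: P_def)
        have "w \<in> A i" using v i sym wS by (auto simp: A_def)
        then show ?thesis using gL(1)[OF i(1)] fq[OF i(1)] i by (auto simp: L_def)
      qed
      then show ?thesis by auto
    qed
    \<comment> \<open>The vertices of a triangle are pairwise adjacent, so properness gives
      injectivity.\<close>
    moreover have "card (N w \<inter> P) \<le> 2 \<or> inj_on f (N w \<inter> P)"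
    proof (cases "l = 3")
      case True
      have "f u \<noteq> f v" if uv: "u \<in> P" "v \<in> P" "u \<noteq> v" for u v
      proof -
        obtain i j where ij: "i < l" "u = q i" "j < l" "v = q j" using uv by (auto simp: P_def)
        then have "j \<noteq> i" using uv by auto
        then have "j = cpred l i \<or> j = csucc l i" using ij True by (auto simp: cpred_def csucc_def)
        then have "v \<in> N u" using nb[OF ij(1)] ij by auto
        then show ?thesis using proper uv by blast
      qed
      then show ?thesis by (auto simp: inj_on_def)
    next
      case l3: False
      then show ?thesis using out[of w] False by (simp add: P_def)
    qed
    ultimately show ?thesis using K(3)[OF wS fS] by blast
  qed
  ultimately have "pcf f" unfolding pcf_def by (metis min.coboundedI2)
  then show ?thesis by blast
qed

lemma pcf_exists_connected:
  assumes ne: "V \<noteq> {}" and conn: "\<And>u v. u \<in> V \<Longrightarrow> v \<in> V \<Longrightarrow> (u, v) \<in> {(a, b). b \<in> N a}\<^sup>*"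
  shows "\<exists>c. pcf c"
proof -
  have color_rest: "\<exists>c. valid c (V - P)" if P: "P \<subseteq> V" "P \<noteq> {}" for P
  proof -
    obtain p0 where p0: "p0 \<in> P" using P by blast
    have "valid (\<lambda>_. 0) {}" by (simp add: valid_def okay_def)
    \<comment> \<open>Connectivity enters here: after its last vertex in \<open>P\<close>, a walk to
      \<open>v\<close> stays in \<open>V - P\<close>.\<close>
    moreover have "\<exists>p\<in>P. (p, v) \<in> (steps (V - P))\<^sup>*" if v: "v \<in> V - P" for v
    proof -
      have "(p0, v) \<in> {(a, b). b \<in> N a}\<^sup>*" using conn p0 P v by blast
      then have "v \<in> P \<or> (\<exists>p\<in>P. (p, v) \<in> (steps (V - P))\<^sup>*)"
      proof (induction)
        case base
        then show ?case using p0 by simp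
      next
        case (step y z)
        then have z: "z \<in> N y" "z \<in> V" using N_sub by auto
        show ?case
        proof (cases "z \<in> P")
          case False
          then have yz: "(y, z) \<in> steps (V - P)" using z by (simp add: steps_def)
          from step.IH show ?thesis
          proof
            assume "y \<in> P"
            then show ?thesis using yz by blast
          next
            assume "\<exists>p\<in>P. (p, y) \<in> (steps (V - P))\<^sup>*"
            then show ?thesis using yz by (meson rtrancl.rtrancl_into_rtrancl)
          qed
        qed simp
      qed
      then show ?thesis using v by blast
    qed
    ultimately have "\<exists>c'. valid c' ({} \<union> (V - P)) \<and> (V - P \<noteq> {} \<longrightarrow>
        (\<exists>p\<in>P. \<exists>x\<in>V - P. x \<in> N p \<and> valid c' ({} \<union> (V - P) - {x})))"
      using finite_V P by (intro valid_extend_toward) auto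
    then show ?thesis by auto
  qed
  show ?thesis
  proof (cases "\<exists>r\<in>V. card (N r) < D")
    case True
    then obtain r where r: "r \<in> V" "card (N r) < D" by blast
    obtain c where "valid c (V - {r})" using color_rest[of "{r}"] r by auto
    then obtain a where "valid (c(r := a)) (insert r (V - {r}))"
      using valid_extend_low_degree[of c "V - {r}" r] r by auto
    then show ?thesis using pcf_if_valid r by (metis insert_Diff)
  next
    case False
    then have reg: "card (N v) = D" if "v \<in> V" for v
      using that deg_le[of v] by force
    then have "2 \<le> card (N v)" if "v \<in> V" for v using that D_ge h_pos by simp
    with ne obtain l q where q: "cyc l q"
      "\<And>i. i < l \<Longrightarrow> N (q i) \<inter> q ` {..<l} = {q (cpred l i), q (csucc l i)}"
      "\<And>w. w \<notin> q ` {..<l} \<Longrightarrow> card (N w \<inter> q ` {..<l}) \<le> 2 \<or> l = 3"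
      by (rule shortest_cycle) blast+
    have l: "3 \<le> l" using q(1) by (simp add: cyc_def)
    have "q i \<in> V" if "i < l" for i
      using q(2)[OF csucc_less[OF that]] cpred_csucc[OF that] N_sub[of "q (csucc l i)"] by auto
    then have "q ` {..<l} \<subseteq> V" "q ` {..<l} \<noteq> {}" using l by (auto simp: lessThan_empty_iff)
    then obtain c where "valid c (V - q ` {..<l})" using color_rest by blast
    then show ?thesis using pcf_on_cycle[OF q reg] by blast
  qed
qed

end

section \<open>Assembling the components\<close>

lemma (in graph) nbhd_facts:
  shows "nbhd G v \<subseteq> verts G" "v \<notin> nbhd G v" "u \<in> nbhd G v \<Longrightarrow> v \<in> nbhd G u"
    "v \<in> nbhd G u \<Longrightarrow> v \<in> verts G \<and> u \<in> verts G"
  using adj_in_verts adj_not_same sym_arcs by (auto simp: nbhd_def symmetric_def dest: symD)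

lemma (in graph) pcf_coloring_exists_max_degree:
  assumes h: "1 \<le> h" and D: "h + 2 \<le> max_degree G"
  shows "\<exists>c. pcf_coloring G h ((h + 1) * max_degree G - 1) c"
proof -
  define D where "D = max_degree G"
  define k where "k = (h + 1) * D - 1"
  define E where "E = {(a, b). b \<in> nbhd G a}"
  define comp where "comp v = {w. (v, w) \<in> E\<^sup>*}" for v
  define N where "N C u = (if u \<in> C then nbhd G u else {})" for C u
  have symE: "sym E" using nbhd_facts(3) by (auto simp: E_def sym_def)
  have deg: "card (nbhd G v) \<le> D" if "v \<in> verts G" for v
    using that finite_verts unfolding D_def max_degree_def vertex_degree_def by (intro Max_ge) auto
  have comp_sub: "comp v \<subseteq> verts G" if "v \<in> verts G" for v
  proof
    fix w assume "w \<in> comp v"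
    then have "(v, w) \<in> E\<^sup>*" by (simp add: comp_def)
    then show "w \<in> verts G" using that nbhd_facts(1) by (induction) (auto simp: E_def)
  qed
  have comp_closed: "b \<in> comp v" if "a \<in> comp v" "b \<in> nbhd G a" for a b v
    using that by (auto simp: comp_def E_def intro: rtrancl_into_rtrancl)
  have comp_eq: "comp b = comp a" if "b \<in> comp a" for a b
  proof -
    have ab: "(a, b) \<in> E\<^sup>*" using that by (simp add: comp_def)
    then have "(b, a) \<in> E\<^sup>*" using sym_rtrancl[OF symE] by (auto dest: symD)
    then show ?thesis using ab by (auto simp: comp_def intro: rtrancl_trans)
  qed
  have inst: "nbr_graph (comp v) (N (comp v)) h D {1..k}" if v: "v \<in> verts G" for v
  proof
    show "finite (comp v)" using comp_sub[OF v] finite_verts finite_subset by blast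
    show "N (comp v) u \<subseteq> comp v" for u using comp_closed by (auto simp: N_def)
    show "u \<notin> N (comp v) u" for u using nbhd_facts(2) by (simp add: N_def)
    show "w \<in> N (comp v) u" if "u \<in> N (comp v) w" for u w
      using that comp_closed nbhd_facts(3) by (auto simp: N_def split: if_splits)
    show "card (N (comp v) u) \<le> D" for u using deg comp_sub[OF v] by (auto simp: N_def)
  qed (use h D in \<open>auto simp: D_def k_def\<close>)
  have ex: "\<exists>c. nbr_graph.pcf (comp v) (N (comp v)) h {1..k} c" if v: "v \<in> verts G" for v
  proof (rule nbr_graph.pcf_exists_connected[OF inst[OF v]])
    show "comp v \<noteq> {}" by (auto simp: comp_def)
    fix a b assume a: "a \<in> comp v" and b: "b \<in> comp v"
    then have "(a, b) \<in> E\<^sup>*" using comp_eq[OF a] by (auto simp: comp_def)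
    then show "(a, b) \<in> {(a, b). b \<in> N (comp v) a}\<^sup>*"
    proof (induction)
      case (step y z)
      have "y \<in> comp v" using step.hyps(1) a by (auto simp: comp_def intro: rtrancl_trans)
      then have "(y, z) \<in> {(a, b). b \<in> N (comp v) a}" using step.hyps(2) by (simp add: N_def E_def)
      then show ?case using step.IH by (rule rtrancl_into_rtrancl[rotated])
    qed simp
  qed
  \<comment> \<open>The choice depends on the component as a set, so all its vertices use the same
    coloring.\<close>
  define F where "F C = (SOME c. nbr_graph.pcf C (N C) h {1..k} c)" for C
  have F: "nbr_graph.pcf (comp v) (N (comp v)) h {1..k} (F (comp v))" if "v \<in> verts G" for v
    unfolding F_def using ex[OF that] by (rule someI_ex)
  define c where "c v = F (comp v) v" for v
  have self: "v \<in> comp v" for v by (simp add: comp_def)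
  have c_nbhd: "c u = F (comp v) u" if "u \<in> nbhd G v" for u v
    using comp_eq[OF comp_closed[OF self that]] by (simp add: c_def)
  have range: "c v \<in> {1..k}" if v: "v \<in> verts G" for v
    using F[OF v] self[of v] unfolding nbr_graph.pcf_def[OF inst[OF v]] c_def by blast
  have proper: "c u \<noteq> c v" if uv: "v \<in> nbhd G u" for u v
  proof -
    have u: "u \<in> verts G" using nbhd_facts(4) uv by blast
    have "F (comp u) u \<noteq> F (comp u) v"
      using F[OF u] self[of u] uv unfolding nbr_graph.pcf_def[OF inst[OF u]] by (auto simp: N_def)
    then show ?thesis using c_nbhd[OF uv] by (simp add: c_def)
  qed
  have "min (vertex_degree G v) h \<le> card {i \<in> {1..k}. card {u \<in> nbhd G v. c u = i} = 1}"
    if v: "v \<in> verts G" for v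
  proof -
    have "min (card (nbhd G v)) h \<le> card (uniques (F (comp v)) (nbhd G v))"
      using F[OF v] self[of v] unfolding nbr_graph.pcf_def[OF inst[OF v]] by (auto simp: N_def)
    also have "uniques (F (comp v)) (nbhd G v) = uniques c (nbhd G v)"
      using c_nbhd by (intro uniques_cong) auto
    also have "\<dots> = {i \<in> {1..k}. card {u \<in> nbhd G v. c u = i} = 1}"
      using uniques_subset[of c "nbhd G v"] range nbhd_facts(1)[of v] by (auto simp: uniques_def)
    finally show ?thesis by (simp add: vertex_degree_def)
  qed
  then have "pcf_coloring G h k c"
    using range proper unfolding pcf_coloring_def proper_coloring_def by (auto simp: nbhd_def)
  then show ?thesis unfolding k_def D_def by blast
qed

theorem theorem1p3:
  fixes G :: "('a, 'b) pre_digraph" and h :: nat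
  assumes "graph G"
    and "h \<ge> 1"
    and "max_degree G \<ge> h + 2"
  shows "pcf_chromatic_number G h \<le> (h + 1) * max_degree G - 1"
proof -
  have "0 < (h + 1) * max_degree G - 1"
    using assms(3) by (cases "max_degree G") auto
  then show ?thesis
    unfolding pcf_chromatic_number_def
    using graph.pcf_coloring_exists_max_degree[OF assms] by (intro Least_le) simp
qed

end
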